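(* Let $X$ be a diffusion on $\mathcal{I}$ as in the context, let $\alpha>0$, and let $g\colon\mathcal{I}\to\mathbb{R}$ be a (non-negative, lower semicontinuous) reward function such that the optimal stopping problem with reward $g$ and discount $\alpha$ is right-sided with optimal threshold $x^*\in(\ell,r)$. Assume that the value function satisfies $$V_\alpha(x)=\int_{(x^*,r]}G_\alpha(x,y)\,(\alpha-L)g(y)\,m(dy)\qquad(x\in\mathcal{I}),$$ and that $g$ is differentiable at $x^*$. Suppose that at least one of the following holds: (i) $\psi_\alpha$ is differentiable at $x^*$ and $\psi_\alpha'(x^* )\neq 0$; or (ii) $m(\{x^*\})=0$, the scale function $s$ is differentiable at $x^*$, and $s'(x^* )\neq 0$. Then the principle of smooth fit holds: $V_\alpha$ is differentiable at $x^*$ and $V_\alpha'(x^* )=g'(x^* )$.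
   Context: $X=\{X_t\colon t\ge 0\}$ is a non-terminating regular one-dimensional diffusion (in the sense of Itô and McKean) with state space an interval $\mathcal{I}\subseteq\mathbb{R}$ with endpoints $\ell=\inf\mathcal{I}$, $r=\sup\mathcal{I}$, $-\infty\le\ell<r\le\infty$. There are no absorbing or killing boundaries; an endpoint belonging to $\mathcal{I}$ is both entrance and exit (reflecting). $\mathbf{E}_x$ is expectation when $X$ starts at $x$. $\mathbf{T}$ is the set of stopping times of the usual augmentation of the natural filtration of $X$. Fix $\alpha>0$. Optimal stopping problem: given a non-negative lower semicontinuous reward $g\colon\mathcal{I}\to\mathbb{R}$, the value function is $V_\alpha(x)=\sup_{\tau\in\mathbf{T}}\mathbf{E}_x\left(e^{-\alpha\tau}g(X_\tau)\right)$, and $\tau^*\in\mathbf{T}$ is optimal if $V_\alpha(x)=\mathbf{E}_x(e^{-\alpha\tau^*}g(X_{\tau^*}))$ for all $x$ (with the convention $e^{-\alpha\tau}g(X_\tau)=0$ on $\{\tau=\infty\}$). The problem is right-sided with optimal threshold $x^*\in\mathcal{I}$ if $\tau^*=\inf\{t\ge0\colon X_t\ge x^*\}$ is optimal. $s$ and $m$ are the scale function and speed measure of $X$. $L$ is the infinitesimal generator; its domain $\mathcal{D}_L$ is the range of the resolvent $R_\alpha u(x)=\int_0^\infty e^{-\alpha t}\mathbf{E}_x(u(X_t))\,dt$ on bounded continuous functions $u$ on $\mathcal I$, with $(\alpha-L)$ inverse to $R_\alpha$. For a function $u\colon\mathcal{I}\to\mathbb{R}$ and $x\in(\ell,r)$,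 $Lu(x)$ means Feller's differential operator $Lu(x)=\frac{\partial}{\partial m}\frac{\partial^+}{\partial s}u(x)$ whenever it makes sense ($\partial^+/\partial s$ is the right derivative with respect to $s$, and one has $\frac{\partial^+u}{\partial s}(z)-\frac{\partial^+u}{\partial s}(y)=\int_{(y,z]}Lu\,dm$ for $u\in\mathcal D_L$); if $\ell\in\mathcal{I}$, $Lu(\ell)=\lim_{x\to\ell^+}Lu(x)$, and if $r\in\mathcal{I}$, $Lu(r)=\lim_{x\to r^-}Lu(x)$, when the limits exist. $(\alpha-L)u=\alpha u-Lu$. $\varphi_\alpha$ (decreasing) and $\psi_\alpha$ (increasing) are the positive continuous solutions of $\alpha u=Lu$ on $\mathcal{I}$, whose linear combinations give all continuous solutions; with $\tau_z=\inf\{t\colon X_t=z\}$, $\mathbf{E}_x(e^{-\alpha\tau_z})=\psi_\alpha(x)/\psi_\alpha(z)$ for $x\le z$ and $=\varphi_\alpha(x)/\varphi_\alpha(z)$ for $x\ge z$. The Wronskian $w_\alpha=\frac{\partial^+\psi_\alpha}{\partial s}(x)\varphi_\alpha(x)-\psi_\alpha(x)\frac{\partial^+\varphi_\alpha}{\partial s}(x)$ is positive and independent of $x$. The Green function is $G_\alpha(x,y)=\int_0^\infty e^{-\alpha t}p(t;x,y)\,dt$, where $p$ is the transition density with respect to $m$; it equals $w_\alpha^{-1}\psi_\alpha(x)\varphi_\alpha(y)$ for $x\le y$ and $w_\alpha^{-1}\psi_\alpha(y)\varphi_\alpha(x)$ for $x\ge y$. Interval convention: $(x,r]$ denotes $\mathcal{I}\cap\{y>x\}$.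 *)

theory Defs
  imports "HOL-Probability.Probability"
begin

section \<open>Filtrations and hitting times of a real-valued process\<close>

text \<open>Time indices of filtrations and values of random times are of type \<^typ>\<open>ennreal\<close>;
  the process itself is indexed by real times, of which only those \<open>\<ge> 0\<close> matter.\<close>

definition natural_filtration :: "'w set \<Rightarrow> (real \<Rightarrow> 'w \<Rightarrow> real) \<Rightarrow> ennreal \<Rightarrow> 'w measure" where
  "natural_filtration \<Omega> X t =
     sigma \<Omega> {X s -` B \<inter> \<Omega> | s B. 0 \<le> s \<and> ennreal s \<le> t \<and> B \<in> sets borel}"

text \<open>The index \<open>u = \<infinity>\<close> is admitted in the intersection so that the value at \<open>t = \<infinity>\<close> is
  the \<open>\<sigma>\<close>-algebra generated by the whole process; it is irrelevant for \<open>t < \<infinity>\<close>.\<close>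

definition right_filtration :: "'w set \<Rightarrow> (real \<Rightarrow> 'w \<Rightarrow> real) \<Rightarrow> ennreal \<Rightarrow> 'w measure" where
  "right_filtration \<Omega> X t =
     sigma \<Omega> (\<Inter>u\<in>{u. t < u \<or> u = \<infinity>}. sets (natural_filtration \<Omega> X u))"

text \<open>Usual augmentation: the right-continuous filtration completed with the null sets of the
  law \<open>\<integral> P x \<mu>(dx)\<close>, intersected over all initial distributions \<open>\<mu>\<close> on \<open>I\<close>.\<close>

definition augmented_filtration ::
  "real set \<Rightarrow> 'w set \<Rightarrow> (real \<Rightarrow> 'w measure) \<Rightarrow> (real \<Rightarrow> 'w \<Rightarrow> real) \<Rightarrow> ennreal \<Rightarrow> 'w measure" where
  "augmented_filtration I \<Omega> P X t = sigma \<Omega>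
     {A. A \<subseteq> \<Omega> \<and>
       (\<forall>\<mu>. prob_space \<mu> \<and> sets \<mu> = sets (restrict_space borel I) \<longrightarrow>
         (\<exists>B\<in>sets (right_filtration \<Omega> X t). \<exists>N\<in>sets (natural_filtration \<Omega> X \<infinity>).
            (\<integral>\<^sup>+x. emeasure (P x) N \<partial>\<mu>) = 0 \<and> (A - B) \<union> (B - A) \<subseteq> N))}"

definition hitting_time :: "(real \<Rightarrow> 'w \<Rightarrow> real) \<Rightarrow> real set \<Rightarrow> 'w \<Rightarrow> ennreal" where
  "hitting_time X A \<omega> = Inf {ennreal t | t. 0 \<le> t \<and> X t \<omega> \<in> A}"

section \<open>Diffusions\<close>

text \<open>\<open>P x\<close> is the law of the process started at \<open>x\<close>. The process never leaves \<open>I\<close>, hence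
  is non-terminating. Regularity is required between all points of \<open>I\<close>, endpoints in \<open>I\<close>
  included: such endpoints are thereby both exit and entrance, and not absorbing.
  The strong Markov property is stated for events \<open>A\<close> in the \<open>\<sigma>\<close>-algebra of the past
  of \<open>T\<close>; the instance \<open>t = \<infinity>\<close> of that condition makes \<open>A\<close> measurable.\<close>

locale diffusion =
  fixes I :: "real set" and \<Omega> :: "'w set"
    and P :: "real \<Rightarrow> 'w measure" and X :: "real \<Rightarrow> 'w \<Rightarrow> real"
  assumes interval: "is_interval I" "interior I \<noteq> {}"
    and prob: "\<And>x. x \<in> I \<Longrightarrow> prob_space (P x)"
    and space_P: "\<And>x. x \<in> I \<Longrightarrow> space (P x) = \<Omega>"
    and sets_P: "\<And>x. x \<in> I \<Longrightarrow> sets (P x) = sets (natural_filtration \<Omega> X \<infinity>)"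
    and state: "\<And>t \<omega>. 0 \<le> t \<Longrightarrow> \<omega> \<in> \<Omega> \<Longrightarrow> X t \<omega> \<in> I"
    and paths: "\<And>\<omega>. \<omega> \<in> \<Omega> \<Longrightarrow> continuous_on {0..} (\<lambda>t. X t \<omega>)"
    and start: "\<And>x. x \<in> I \<Longrightarrow> AE \<omega> in P x. X 0 \<omega> = x"
    and kernel: "\<And>A. A \<in> sets (natural_filtration \<Omega> X \<infinity>) \<Longrightarrow>
      (\<lambda>x. emeasure (P x) A) \<in> borel_measurable (restrict_space borel I)"
    and strong_markov: "\<And>x T A t B. x \<in> I \<Longrightarrow> stopping_time (right_filtration \<Omega> X) T \<Longrightarrow>
      (\<forall>t. {\<omega>\<in>A. T \<omega> \<le> t} \<in> sets (right_filtration \<Omega> X t)) \<Longrightarrow> 0 \<le> t \<Longrightarrow> B \<in> sets borel \<Longrightarrow>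
      emeasure (P x) {\<omega>\<in>A. T \<omega> < \<infinity> \<and> X (enn2real (T \<omega>) + t) \<omega> \<in> B} =
      (\<integral>\<^sup>+\<omega>\<in>{\<omega>\<in>A. T \<omega> < \<infinity>}. emeasure (P (X (enn2real (T \<omega>)) \<omega>)) {\<omega>'\<in>\<Omega>. X t \<omega>' \<in> B} \<partial>P x)"
    and regular: "\<And>x y. x \<in> I \<Longrightarrow> y \<in> I \<Longrightarrow>
      emeasure (P x) {\<omega>\<in>\<Omega>. hitting_time X {y} \<omega> < \<infinity>} > 0"

definition scale_function ::
  "real set \<Rightarrow> 'w set \<Rightarrow> (real \<Rightarrow> 'w measure) \<Rightarrow> (real \<Rightarrow> 'w \<Rightarrow> real) \<Rightarrow> (real \<Rightarrow> real) \<Rightarrow> bool" where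
  "scale_function I \<Omega> P X s \<longleftrightarrow>
     continuous_on I s \<and> strict_mono_on I s \<and>
     (\<forall>a\<in>I. \<forall>b\<in>I. \<forall>x. a < x \<and> x < b \<longrightarrow>
        measure (P x) {\<omega>\<in>\<Omega>. hitting_time X {a} \<omega> < hitting_time X {b} \<omega>} =
          (s b - s x) / (s b - s a))"

text \<open>The speed measure in the normalization in which the generator is \<open>d/dm d/ds\<close>, i.e. the mean
  exit time from \<open>(a, b)\<close> is the integral of the Green kernel of \<open>- d/dm d/ds\<close> with Dirichlet
  conditions at \<open>a\<close> and \<open>b\<close>. This determines \<open>m\<close> inside \<open>I\<close>; the last two clauses also
  determine its mass at the endpoints belonging to \<open>I\<close>.\<close>

definition speed_measure ::
  "real set \<Rightarrow> (real \<Rightarrow> 'w measure) \<Rightarrow> (real \<Rightarrow> 'w \<Rightarrow> real) \<Rightarrow> (real \<Rightarrow> real) \<Rightarrow> real measure \<Rightarrow> bool" where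
  "speed_measure I P X s m \<longleftrightarrow>
     sets m = sets borel \<and> emeasure m (- I) = 0 \<and>
     (\<forall>a b. a < b \<and> {a..b} \<subseteq> I \<longrightarrow> 0 < emeasure m {a<..<b} \<and> emeasure m {a..b} < \<infinity>) \<and>
     (\<forall>a\<in>I. \<forall>b\<in>I. \<forall>x. a < x \<and> x < b \<longrightarrow>
        (\<integral>\<^sup>+\<omega>. min (hitting_time X {a} \<omega>) (hitting_time X {b} \<omega>) \<partial>P x) =
        (\<integral>\<^sup>+y\<in>{a<..<b}. ennreal ((s (min x y) - s a) * (s b - s (max x y)) / (s b - s a)) \<partial>m)) \<and>
     (\<forall>r\<in>I. (\<forall>y\<in>I. y \<le> r) \<longrightarrow> (\<forall>a\<in>I. \<forall>x\<in>I. a < x \<longrightarrow>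
        (\<integral>\<^sup>+\<omega>. hitting_time X {a} \<omega> \<partial>P x) =
        (\<integral>\<^sup>+y\<in>{a<..r}. ennreal (s (min x y) - s a) \<partial>m))) \<and>
     (\<forall>l\<in>I. (\<forall>y\<in>I. l \<le> y) \<longrightarrow> (\<forall>b\<in>I. \<forall>x\<in>I. x < b \<longrightarrow>
        (\<integral>\<^sup>+\<omega>. hitting_time X {b} \<omega> \<partial>P x) =
        (\<integral>\<^sup>+y\<in>{l..<b}. ennreal (s b - s (max x y)) \<partial>m)))"

section \<open>Feller's differential operator\<close>

definition has_right_scale_derivative ::
  "(real \<Rightarrow> real) \<Rightarrow> (real \<Rightarrow> real) \<Rightarrow> real \<Rightarrow> real \<Rightarrow> bool" where
  "has_right_scale_derivative s u D x \<longleftrightarrow>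
     ((\<lambda>y. (u y - u x) / (s y - s x)) \<longlongrightarrow> D) (at_right x)"

definition right_scale_derivative :: "(real \<Rightarrow> real) \<Rightarrow> (real \<Rightarrow> real) \<Rightarrow> real \<Rightarrow> real" where
  "right_scale_derivative s u x = (THE D. has_right_scale_derivative s u D x)"

text \<open>Derivative with respect to \<open>m\<close> along intervals \<open>(y, z]\<close>, \<open>y < x \<le> z\<close>, shrinking to \<open>x\<close>.
  The intervals contain \<open>x\<close>, so that at an atom of \<open>m\<close> it is the jump of \<open>f\<close> divided by
  the mass of the atom. If \<open>f z - f y\<close> is the integral of \<open>h\<close> over \<open>(y, z]\<close> with \<open>h\<close>
  continuous, the derivative is \<open>h x\<close>.\<close>

definition has_speed_derivative ::
  "real measure \<Rightarrow> (real \<Rightarrow> real) \<Rightarrow> real \<Rightarrow> real \<Rightarrow> bool" where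
  "has_speed_derivative m f D x \<longleftrightarrow>
     ((\<lambda>(y, z). (f z - f y) / measure m {y<..z}) \<longlongrightarrow> D)
       (at_left x \<times>\<^sub>F inf (nhds x) (principal {x..}))"

definition has_feller_interior ::
  "(real \<Rightarrow> real) \<Rightarrow> real measure \<Rightarrow> (real \<Rightarrow> real) \<Rightarrow> real \<Rightarrow> real \<Rightarrow> bool" where
  "has_feller_interior s m u D x \<longleftrightarrow>
     (\<forall>\<^sub>F y in nhds x. \<exists>d. has_right_scale_derivative s u d y) \<and>
     has_speed_derivative m (right_scale_derivative s u) D x"

text \<open>\<open>L u (x)\<close> exists and equals \<open>D\<close>; at an endpoint of \<open>I\<close> it is a limit from inside.\<close>

definition has_feller ::
  "real set \<Rightarrow> (real \<Rightarrow> real) \<Rightarrow> real measure \<Rightarrow> (real \<Rightarrow> real) \<Rightarrow> real \<Rightarrow> real \<Rightarrow> bool" where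
  "has_feller I s m u D x \<longleftrightarrow>
     (if x \<in> interior I then has_feller_interior s m u D x
      else \<exists>h. (\<forall>\<^sub>F y in at x within interior I. has_feller_interior s m u (h y) y) \<and>
               (h \<longlongrightarrow> D) (at x within interior I))"

definition feller_op ::
  "real set \<Rightarrow> (real \<Rightarrow> real) \<Rightarrow> real measure \<Rightarrow> (real \<Rightarrow> real) \<Rightarrow> real \<Rightarrow> real" where
  "feller_op I s m u x = (THE D. has_feller I s m u D x)"

section \<open>Fundamental solutions and Green function\<close>

text \<open>\<open>exp (- \<alpha> t)\<close>, with value \<open>0\<close> at \<open>t = \<infinity>\<close>.\<close>

definition discount :: "real \<Rightarrow> ennreal \<Rightarrow> ennreal" where
  "discount \<alpha> t = (if t = \<infinity> then 0 else ennreal (exp (- \<alpha> * enn2real t)))"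

definition alpha_harmonic ::
  "real set \<Rightarrow> (real \<Rightarrow> real) \<Rightarrow> real measure \<Rightarrow> real \<Rightarrow> (real \<Rightarrow> real) \<Rightarrow> bool" where
  "alpha_harmonic I s m \<alpha> u \<longleftrightarrow>
     continuous_on I u \<and> (\<forall>x\<in>I. has_feller I s m u (\<alpha> * u x) x)"

text \<open>The Laplace transforms of the hitting times determine both functions up to positive factors;
  at an endpoint belonging to \<open>I\<close> they replace a boundary condition, which the equation
  \<open>\<alpha> u = L u\<close> on \<open>I\<close> alone does not contain.\<close>

definition fundamental_solutions ::
  "real set \<Rightarrow> (real \<Rightarrow> 'w measure) \<Rightarrow> (real \<Rightarrow> 'w \<Rightarrow> real) \<Rightarrow> (real \<Rightarrow> real) \<Rightarrow> real measure \<Rightarrow>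
     real \<Rightarrow> (real \<Rightarrow> real) \<Rightarrow> (real \<Rightarrow> real) \<Rightarrow> bool" where
  "fundamental_solutions I P X s m \<alpha> \<phi> \<psi> \<longleftrightarrow>
     (\<forall>x\<in>I. 0 < \<phi> x) \<and> (\<forall>x\<in>I. 0 < \<psi> x) \<and> antimono_on I \<phi> \<and> mono_on I \<psi> \<and>
     alpha_harmonic I s m \<alpha> \<phi> \<and> alpha_harmonic I s m \<alpha> \<psi> \<and>
     (\<forall>x\<in>I. \<forall>z\<in>I. x \<le> z \<longrightarrow>
        (\<integral>\<^sup>+\<omega>. discount \<alpha> (hitting_time X {z} \<omega>) \<partial>P x) = ennreal (\<psi> x / \<psi> z)) \<and>
     (\<forall>x\<in>I. \<forall>z\<in>I. z \<le> x \<longrightarrow>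
        (\<integral>\<^sup>+\<omega>. discount \<alpha> (hitting_time X {z} \<omega>) \<partial>P x) = ennreal (\<phi> x / \<phi> z))"

text \<open>For given \<open>x\<close> this determines \<open>p\<close>, and hence the Green function, up to \<open>m\<close>-null sets of
  \<open>y\<close>, which suffices because the Green function is only integrated against \<open>m\<close>.\<close>

definition transition_density ::
  "real set \<Rightarrow> 'w set \<Rightarrow> (real \<Rightarrow> 'w measure) \<Rightarrow> (real \<Rightarrow> 'w \<Rightarrow> real) \<Rightarrow> real measure \<Rightarrow>
     (real \<Rightarrow> real \<Rightarrow> real \<Rightarrow> real) \<Rightarrow> bool" where
  "transition_density I \<Omega> P X m p \<longleftrightarrow>
     (\<forall>t>0. \<forall>x\<in>I. \<forall>y\<in>I. 0 \<le> p t x y) \<and>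
     (\<forall>x\<in>I. (\<lambda>(t, y). p t x y) \<in> borel_measurable (restrict_space borel ({0<..} \<times> I))) \<and>
     (\<forall>t>0. \<forall>x\<in>I. \<forall>B\<in>sets borel.
        emeasure (P x) {\<omega>\<in>\<Omega>. X t \<omega> \<in> B} = (\<integral>\<^sup>+y\<in>B \<inter> I. ennreal (p t x y) \<partial>m))"

definition green_function ::
  "(real \<Rightarrow> real \<Rightarrow> real \<Rightarrow> real) \<Rightarrow> real \<Rightarrow> real \<Rightarrow> real \<Rightarrow> real" where
  "green_function p \<alpha> x y = (LINT t:{0<..}|lborel. exp (- \<alpha> * t) * p t x y)"

section \<open>Optimal stopping\<close>

definition lower_semicontinuous_on :: "real set \<Rightarrow> (real \<Rightarrow> real) \<Rightarrow> bool" where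
  "lower_semicontinuous_on I g \<longleftrightarrow>
     (\<forall>x\<in>I. \<forall>a. a < g x \<longrightarrow> (\<forall>\<^sub>F y in at x within I. a < g y))"

definition stopping_times ::
  "real set \<Rightarrow> 'w set \<Rightarrow> (real \<Rightarrow> 'w measure) \<Rightarrow> (real \<Rightarrow> 'w \<Rightarrow> real) \<Rightarrow> ('w \<Rightarrow> ennreal) set" where
  "stopping_times I \<Omega> P X = {\<tau>. stopping_time (augmented_filtration I \<Omega> P X) \<tau>}"

text \<open>The expectation is taken under the completion of \<open>P x\<close>, since stopping times of the augmented
  filtration are only measurable with respect to the completion.\<close>

definition expected_reward ::
  "(real \<Rightarrow> 'w measure) \<Rightarrow> (real \<Rightarrow> 'w \<Rightarrow> real) \<Rightarrow> real \<Rightarrow> (real \<Rightarrow> real) \<Rightarrow> ('w \<Rightarrow> ennreal) \<Rightarrow> real \<Rightarrow> ennreal" where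
  "expected_reward P X \<alpha> g \<tau> x =
     (\<integral>\<^sup>+\<omega>. discount \<alpha> (\<tau> \<omega>) * ennreal (g (X (enn2real (\<tau> \<omega>)) \<omega>)) \<partial>completion (P x))"

definition value_function ::
  "real set \<Rightarrow> 'w set \<Rightarrow> (real \<Rightarrow> 'w measure) \<Rightarrow> (real \<Rightarrow> 'w \<Rightarrow> real) \<Rightarrow> real \<Rightarrow> (real \<Rightarrow> real) \<Rightarrow> real \<Rightarrow> ennreal" where
  "value_function I \<Omega> P X \<alpha> g x = (SUP \<tau>\<in>stopping_times I \<Omega> P X. expected_reward P X \<alpha> g \<tau> x)"

definition optimal_stopping_time ::
  "real set \<Rightarrow> 'w set \<Rightarrow> (real \<Rightarrow> 'w measure) \<Rightarrow> (real \<Rightarrow> 'w \<Rightarrow> real) \<Rightarrow> real \<Rightarrow> (real \<Rightarrow> real) \<Rightarrow>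
     ('w \<Rightarrow> ennreal) \<Rightarrow> bool" where
  "optimal_stopping_time I \<Omega> P X \<alpha> g \<tau> \<longleftrightarrow>
     \<tau> \<in> stopping_times I \<Omega> P X \<and>
     (\<forall>x\<in>I. value_function I \<Omega> P X \<alpha> g x = expected_reward P X \<alpha> g \<tau> x)"

definition right_sided ::
  "real set \<Rightarrow> 'w set \<Rightarrow> (real \<Rightarrow> 'w measure) \<Rightarrow> (real \<Rightarrow> 'w \<Rightarrow> real) \<Rightarrow> real \<Rightarrow> (real \<Rightarrow> real) \<Rightarrow>
     real \<Rightarrow> bool" where
  "right_sided I \<Omega> P X \<alpha> g xs \<longleftrightarrow>
     xs \<in> I \<and> optimal_stopping_time I \<Omega> P X \<alpha> g (hitting_time X {xs..})"

end

theory Submission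
  imports Defs
begin

text \<open>Let \<open>a\<close> be the threshold and \<open>c = V a / \<psi> a\<close>. By the strong Markov property at the hitting time of
  \<open>z\<close>, the occupation measure of \<open>X\<close> started at \<open>x\<close> dominates \<open>E\<^sub>x (exp (- \<alpha> \<tau>\<^sub>z))\<close> times the one of \<open>X\<close>
  started at \<open>z\<close>, with equality on sets to the right of \<open>z\<close> if \<open>x \<le> z\<close>. In terms of the Green function this gives, for
  almost every \<open>y > a\<close>, \<open>G x y = (\<psi> x / \<psi> a) G a y\<close> if \<open>x \<le> a\<close> and
  \<open>\<bar>(\<psi> x / \<psi> a) G a y - G x y\<bar> \<le> \<delta> x * G a y\<close> if \<open>x > a\<close>, with \<open>\<delta> x = \<psi> x / \<psi> a - \<phi> x / \<phi> a\<close>, where the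
  left-hand side vanishes for \<open>y > x\<close>. Hence \<open>V = c \<psi>\<close> to the left of \<open>a\<close> and \<open>V - c \<psi> = o(\<delta>) = o(s - s a)\<close> to the
  right of \<open>a\<close>. Under (i) as under (ii),
  \<open>\<psi>\<close> is differentiable at \<open>a\<close> and \<open>s\<close> has a right derivative there, so \<open>V\<close> has derivative
  \<open>c \<psi>' a\<close> at \<open>a\<close>. As the stopping time vanishes at starting points \<open>x \<ge> a\<close>, \<open>V = g\<close> on that side, which identifies
  the derivative as \<open>g' a\<close>.\<close>

section \<open>Right derivatives with respect to the scale\<close>

lemma has_right_scale_derivative_unique:
  assumes "has_right_scale_derivative s u d x" "has_right_scale_derivative s u e x"
  shows "d = e"
  using assms unfolding has_right_scale_derivative_def
  by (rule tendsto_unique[OF trivial_limit_at_right_real])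

lemma right_scale_derivative_eq:
  assumes "has_right_scale_derivative s u d x"
  shows "right_scale_derivative s u x = d"
  unfolding right_scale_derivative_def
  using assms has_right_scale_derivative_unique by blast

lemma has_right_scale_derivative_uminus:
  assumes "has_right_scale_derivative s u d x"
  shows "has_right_scale_derivative s (\<lambda>y. - u y) (- d) x"
proof -
  have "(\<lambda>y. (- u y - - u x) / (s y - s x)) = (\<lambda>y. - ((u y - u x) / (s y - s x)))"
    by (simp add: fun_eq_iff minus_divide_left)
  then show ?thesis
    using assms unfolding has_right_scale_derivative_def by (simp add: tendsto_minus)
qed

text \<open>A mean value inequality from one-sided derivatives: with \<open>h = u - M s\<close>, the
  last point \<open>c\<close> of \<open>[a, b]\<close> where \<open>h c \<le> h a\<close> has to be
  \<open>b\<close>, because a right derivative of \<open>u\<close> strictly below \<open>M\<close>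
  makes \<open>h\<close> drop just to the right of any earlier point.\<close>

lemma scale_increment_le_of_right_derivative:
  assumes ab: "a < b" and s: "strict_mono_on {a..b} s"
    and cont: "continuous_on {a..b} s" "continuous_on {a..b} u"
    and D: "\<And>y. a \<le> y \<Longrightarrow> y < b \<Longrightarrow> \<exists>d<M. has_right_scale_derivative s u d y"
  shows "u b - u a \<le> M * (s b - s a)"
proof -
  define h where "h = (\<lambda>x. u x - M * s x)"
  have cont_h: "continuous_on {a..b} h"
    unfolding h_def by (intro continuous_intros cont)
  define S where "S = {x\<in>{a..b}. h x \<le> h a}"
  have "S = {a..b} \<inter> h -` {..h a}"
    by (auto simp: S_def)
  then have cl: "closed S"
    using cont_h by (simp add: continuous_closed_preimage)
  have ne: "S \<noteq> {}" and bdd: "bdd_above S"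
    using ab by (auto simp: S_def bdd_above_def intro: exI[of _ a])
  define c where "c = Sup S"
  have c: "c \<in> S"
    unfolding c_def using closed_contains_Sup ne bdd cl by blast
  have "c = b"
  proof (rule ccontr)
    assume "c \<noteq> b"
    with c have cb: "a \<le> c" "c < b"
      by (auto simp: S_def)
    then obtain d where d: "d < M" "has_right_scale_derivative s u d c"
      using D by blast
    have "\<forall>\<^sub>F y in at_right c. (u y - u c) / (s y - s c) < M"
      using d(2,1) unfolding has_right_scale_derivative_def by (rule order_tendstoD(2))
    moreover have "\<forall>\<^sub>F y in at_right c. y \<in> {c<..<b}"
      using cb(2) by (rule eventually_at_right_real)
    ultimately have "\<forall>\<^sub>F y in at_right c. y \<in> {c<..<b} \<and> (u y - u c) / (s y - s c) < M"
      by (auto elim: eventually_elim2)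
    then obtain y where y: "c < y" "y < b" "(u y - u c) / (s y - s c) < M"
      using eventually_happens trivial_limit_at_right_real[of c] by fastforce
    have "s c < s y"
      using s y cb by (auto intro: strict_mono_onD)
    with y(3) have "u y - u c < M * (s y - s c)"
      by (simp add: pos_divide_less_eq)
    then have "h y \<le> h c"
      by (simp add: h_def algebra_simps)
    with c y cb have "y \<in> S"
      by (auto simp: S_def)
    then have "y \<le> c"
      unfolding c_def using bdd by (rule cSup_upper)
    with y show False
      by simp
  qed
  with c show ?thesis
    by (auto simp: S_def h_def algebra_simps)
qed

text \<open>The mean value inequality on \<open>[y, b]\<close> bounds the quotient by any
  \<open>M\<close> above the values of \<open>D\<close> near \<open>b\<close>; applied to
  \<open>- u\<close> it gives the bound from below. So the left scale derivative exists and is the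
  left limit of the right ones.\<close>

lemma scale_derivative_from_left:
  assumes ab: "a < b" and s: "strict_mono_on {a..b} s"
    and cont: "continuous_on {a..b} s" "continuous_on {a..b} u"
    and D: "\<And>y. a \<le> y \<Longrightarrow> y < b \<Longrightarrow> has_right_scale_derivative s u (D y) y"
    and lim: "(D \<longlongrightarrow> d) (at_left b)"
  shows "((\<lambda>y. (u y - u b) / (s y - s b)) \<longlongrightarrow> d) (at_left b)"
proof -
  have upper: "\<forall>\<^sub>F y in at_left b. (v y - v b) / (s y - s b) < e"
    if cont_v: "continuous_on {a..b} v"
      and E: "\<And>y. a \<le> y \<Longrightarrow> y < b \<Longrightarrow> has_right_scale_derivative s v (E y) y"
      and lim_E: "(E \<longlongrightarrow> e') (at_left b)" and "e' < e" for v E e' e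
  proof -
    \<comment> \<open>The mean value inequality yields only \<open>\<le> M\<close>; the gap between
      \<open>M\<close> and \<open>e\<close> makes the final bound strict.\<close>
    obtain M where M: "e' < M" "M < e"
      using \<open>e' < e\<close> dense by blast
    have "\<forall>\<^sub>F y in at_left b. E y < M"
      using lim_E M(1) by (rule order_tendstoD(2))
    then obtain c where c: "c < b" "\<And>y. c < y \<Longrightarrow> y < b \<Longrightarrow> E y < M"
      unfolding eventually_at_left_field by blast
    have "\<forall>\<^sub>F y in at_left b. y \<in> {max a c<..<b}"
      using ab c(1) by (intro eventually_at_left_real) auto
    then show ?thesis
    proof eventually_elim
      case (elim y)
      have sub: "{y..b} \<subseteq> {a..b}"
        using elim by auto
      have "v b - v y \<le> M * (s b - s y)"
      proof (rule scale_increment_le_of_right_derivative)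
        show "\<exists>d<M. has_right_scale_derivative s v d w" if "y \<le> w" "w < b" for w
          using elim that by (intro exI[of _ "E w"]) (auto intro: c E)
      qed (use elim sub cont cont_v s in
          \<open>auto intro: continuous_on_subset monotone_on_subset\<close>)
      moreover have sy: "s y < s b"
        using elim s ab by (auto intro: strict_mono_onD)
      ultimately have "(v b - v y) / (s b - s y) \<le> M"
        by (simp add: pos_divide_le_eq)
      moreover have "(v y - v b) / (s y - s b) = (v b - v y) / (s b - s y)"
        by (metis minus_diff_eq minus_divide_divide)
      ultimately show ?case
        using M by simp
    qed
  qed
  show ?thesis
  proof (rule order_tendstoI)
    fix e assume "d < e"
    then show "\<forall>\<^sub>F y in at_left b. (u y - u b) / (s y - s b) < e"
      using upper[OF cont(2) D lim] by blast
  next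
    fix e assume "e < d"
    then have "\<forall>\<^sub>F y in at_left b. (- u y - - u b) / (s y - s b) < - e"
      using upper[of "\<lambda>y. - u y" "\<lambda>y. - D y" "- d" "- e"] cont(2) D lim
      by (auto intro!: continuous_intros tendsto_intros has_right_scale_derivative_uminus)
    then show "\<forall>\<^sub>F y in at_left b. e < (u y - u b) / (s y - s b)"
    proof eventually_elim
      case (elim y)
      have "(- u y - - u b) / (s y - s b) = - ((u y - u b) / (s y - s b))"
        by (simp add: minus_divide_left)
      with elim show ?case
        by linarith
    qed
  qed
qed

section \<open>Scale derivatives of \<alpha>-harmonic functions\<close>

lemma alpha_harmonicD:
  assumes "alpha_harmonic I s m \<alpha> u" "x \<in> interior I"
  shows "has_feller_interior s m u (\<alpha> * u x) x"
proof -
  have "has_feller I s m u (\<alpha> * u x) x"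
    using assms interior_subset[of I] unfolding alpha_harmonic_def by blast
  then show ?thesis
    using assms(2) by (simp add: has_feller_def)
qed

lemma has_feller_interior_right_derivative:
  assumes "has_feller_interior s m u D x"
  shows "\<forall>\<^sub>F y in nhds x. has_right_scale_derivative s u (right_scale_derivative s u y) y"
proof -
  have "\<forall>\<^sub>F y in nhds x. \<exists>d. has_right_scale_derivative s u d y"
    using assms by (simp add: has_feller_interior_def)
  then show ?thesis
    by eventually_elim (auto simp: right_scale_derivative_eq)
qed

text \<open>The right end of the intervals \<open>(y, z]\<close> may be frozen at
  \<open>z = x\<close>, because the filter in \<open>has_speed_derivative\<close> admits
  \<open>x\<close> itself on that side.\<close>

lemma has_feller_interior_left_quotient:
  assumes "has_feller_interior s m u D x"
  shows "((\<lambda>y. (right_scale_derivative s u x - right_scale_derivative s u y) / measure m {y<..x})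
           \<longlongrightarrow> D) (at_left x)"
proof -
  have "filterlim (\<lambda>y. (y, x)) (at_left x \<times>\<^sub>F inf (nhds x) (principal {x..})) (at_left x)"
    by (intro filterlim_Pair filterlim_ident)
      (auto simp: filterlim_inf filterlim_principal)
  from filterlim_compose[OF _ this] assms show ?thesis
    by (fastforce simp: has_feller_interior_def has_speed_derivative_def)
qed

text \<open>The intervals \<open>(a, x]\<close> shrink to the empty set as \<open>x\<close>
  decreases to \<open>a\<close>, so dominated convergence applies with \<open>norm (h y)\<close> as
  bound. An atom at \<open>a\<close> does no harm, since \<open>a\<close> itself is left
  out.\<close>

lemma set_integral_at_right_tendsto_zero:
  fixes h :: "real \<Rightarrow> real"
  assumes h: "integrable M h" and sets_M [measurable_cong]: "sets M = sets borel"
  shows "((\<lambda>x. LINT y:{a<..x}|M. h y) \<longlongrightarrow> 0) (at_right a)"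
proof (rule tendsto_at_right_sequentially[of a "a + 1"])
  fix S :: "nat \<Rightarrow> real"
  assume S: "S \<longlonglongrightarrow> a"
  have [measurable]: "h \<in> borel_measurable M"
    using h by simp
  have "(\<lambda>n. \<integral>y. indicator {a<..S n} y *\<^sub>R h y \<partial>M) \<longlonglongrightarrow> (\<integral>y. 0 \<partial>M)"
  proof (rule integral_dominated_convergence[where w = "\<lambda>y. norm (h y)"])
    show "AE y in M. (\<lambda>n. indicator {a<..S n} y *\<^sub>R h y) \<longlonglongrightarrow> 0"
    proof (rule AE_I2)
      fix y
      have "\<forall>\<^sub>F n in sequentially. indicator {a<..S n} y *\<^sub>R h y = 0"
      proof (cases "a < y")
        case True
        then have "\<forall>\<^sub>F n in sequentially. S n < y"
          using S by (rule order_tendstoD(2)[rotated])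
        then show ?thesis
          by eventually_elim (auto simp: indicator_def)
      qed auto
      then show "(\<lambda>n. indicator {a<..S n} y *\<^sub>R h y) \<longlonglongrightarrow> 0"
        by (rule tendsto_eventually)
    qed
    show "AE y in M. norm (indicator {a<..S n} y *\<^sub>R h y) \<le> norm (h y)" for n
      by (auto simp: indicator_def)
  qed (use h in auto)
  then show "(\<lambda>n. LINT y:{a<..S n}|M. h y) \<longlonglongrightarrow> 0"
    by (simp add: set_lebesgue_integral_def)
qed simp

lemma eventually_at_side_interior:
  fixes x :: real
  assumes "x \<in> interior I"
  shows "\<forall>\<^sub>F y in at_right x. y \<in> I \<and> x < y" "\<forall>\<^sub>F y in at_left x. y \<in> I \<and> y < x"
proof -
  have "\<forall>\<^sub>F y in nhds x. y \<in> I"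
    using assms interior_subset[of I] by (auto intro: eventually_nhds_in_open[THEN eventually_mono])
  then have "\<forall>\<^sub>F y in at x. y \<in> I"
    by (auto simp: eventually_at_filter elim: eventually_mono)
  then have I: "\<forall>\<^sub>F y in at_right x. y \<in> I" "\<forall>\<^sub>F y in at_left x. y \<in> I"
    by (auto simp: eventually_at_split)
  show "\<forall>\<^sub>F y in at_right x. y \<in> I \<and> x < y"
    using I(1) eventually_at_right_less by eventually_elim simp
  have "\<forall>\<^sub>F y in at_left x. y < x"
    by (auto simp: eventually_at_filter)
  with I(2) show "\<forall>\<^sub>F y in at_left x. y \<in> I \<and> y < x"
    by eventually_elim simp
qed

lemma has_right_scale_derivative_nonneg:
  assumes "has_right_scale_derivative s u d x" and x: "x \<in> interior I"
    and s: "strict_mono_on I s" and u: "mono_on I u"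
  shows "0 \<le> d"
proof (rule tendsto_lowerbound)
  show "((\<lambda>y. (u y - u x) / (s y - s x)) \<longlongrightarrow> d) (at_right x)"
    using assms(1) by (simp add: has_right_scale_derivative_def)
  have "x \<in> I"
    using x interior_subset by blast
  show "\<forall>\<^sub>F y in at_right x. 0 \<le> (u y - u x) / (s y - s x)"
    using eventually_at_side_interior(1)[OF x]
  proof eventually_elim
    case (elim y)
    then have "s x < s y" "u x \<le> u y"
      using s u \<open>x \<in> I\<close> by (auto intro: strict_mono_onD mono_onD)
    then show ?case
      by simp
  qed
qed simp

lemma alpha_harmonic_right_derivative:
  assumes "alpha_harmonic I s m \<alpha> u" and "x \<in> interior I"
  shows "has_right_scale_derivative s u (right_scale_derivative s u x) x"
  using has_feller_interior_right_derivative[OF alpha_harmonicD[OF assms]]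
  by (rule eventually_nhds_x_imp_x)

text \<open>The speed derivative of the right scale derivative at \<open>x\<close> is
  \<open>\<alpha> * u x > 0\<close>. Hence the value at \<open>x\<close> strictly exceeds the values
  just to the left, which are nonnegative by monotonicity.\<close>

lemma alpha_harmonic_right_derivative_pos:
  assumes u: "alpha_harmonic I s m \<alpha> u" and x: "x \<in> interior I"
    and s: "strict_mono_on I s" and mono: "mono_on I u" and "0 < \<alpha>" "0 < u x"
  shows "0 < right_scale_derivative s u x"
proof -
  let ?D = "right_scale_derivative s u"
  have "\<forall>\<^sub>F y in at_left x. 0 < (?D x - ?D y) / measure m {y<..x}"
    using has_feller_interior_left_quotient[OF alpha_harmonicD[OF u x]]
    by (rule order_tendstoD(1)) (simp add: \<open>0 < \<alpha>\<close> \<open>0 < u x\<close>)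
  moreover have "\<forall>\<^sub>F y in at_left x. y \<in> interior I \<and> y < x"
    using x by (intro eventually_at_side_interior(2)) simp
  ultimately have "\<forall>\<^sub>F y in at_left x. 0 < ?D x"
  proof eventually_elim
    case (elim y)
    have "0 \<le> ?D y"
      using elim alpha_harmonic_right_derivative[OF u, of y] s mono
      by (intro has_right_scale_derivative_nonneg) auto
    moreover have "0 < ?D x - ?D y"
      using elim measure_nonneg[of m "{y<..x}"] by (simp add: zero_less_divide_iff not_less[symmetric])
    ultimately show ?case
      by simp
  qed
  then show ?thesis
    by (simp add: eventually_const)
qed

text \<open>Continuity of \<open>m\<close> from above along \<open>(y, b]\<close>. The point
  \<open>b\<close> lies in all these intervals, so the limit keeps the atom there, which governs the
  left scale derivative below.\<close>

lemma measure_left_half_open_tendsto: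
  fixes m :: "real measure"
  assumes ab: "a < b" and sets_m: "sets m = sets borel" and fin: "emeasure m {a..b} < \<infinity>"
  shows "((\<lambda>y. measure m {y<..b}) \<longlongrightarrow> measure m {b}) (at_left b)"
proof (rule tendsto_at_left_sequentially[OF ab])
  fix S :: "nat \<Rightarrow> real"
  assume S: "\<And>n. S n < b" "\<And>n. a < S n" "incseq S" "S \<longlonglongrightarrow> b"
  have "(\<lambda>n. measure m {S n<..b}) \<longlonglongrightarrow> measure m (\<Inter>n. {S n<..b})"
  proof (rule Lim_measure_decseq)
    show "decseq (\<lambda>n. {S n<..b})"
      using \<open>incseq S\<close> by (auto simp: decseq_def incseq_def) (meson le_less_trans)
    fix n
    have "emeasure m {S n<..b} \<le> emeasure m {a..b}"
      using S(2)[of n] by (intro emeasure_mono) (auto simp: sets_m)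
    with fin show "emeasure m {S n<..b} \<noteq> \<infinity>"
      by auto
  qed (auto simp: sets_m)
  moreover have "(\<Inter>n. {S n<..b}) = {b}"
  proof -
    have "y = b" if y: "\<And>n. S n < y" "y \<le> b" for y
      using S(4) y LIMSEQ_le_const2[of S b y] by (meson antisym less_imp_le)
    then show ?thesis
      using S(1) by auto
  qed
  ultimately show "(\<lambda>n. measure m {S n<..b}) \<longlonglongrightarrow> measure m {b}"
    by simp
qed

text \<open>An atom of \<open>m\<close> is the only obstruction to a two-sided scale derivative: it is where the right
  derivative of an \<open>\<alpha>\<close>-harmonic function jumps.\<close>

lemma alpha_harmonic_left_derivative:
  assumes u: "alpha_harmonic I s m \<alpha> u" and x: "x \<in> interior I"
    and s: "strict_mono_on I s" "continuous_on I s"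
    and sets_m: "sets m = sets borel"
    and pos: "\<And>a b. a < b \<Longrightarrow> {a..b} \<subseteq> I \<Longrightarrow> 0 < emeasure m {a<..<b}"
    and fin: "\<And>a b. a < b \<Longrightarrow> {a..b} \<subseteq> I \<Longrightarrow> emeasure m {a..b} < \<infinity>"
    and atom: "measure m {x} = 0"
  shows "((\<lambda>y. (u y - u x) / (s y - s x)) \<longlongrightarrow> right_scale_derivative s u x) (at_left x)"
proof -
  let ?D = "right_scale_derivative s u"
  obtain e where e: "0 < e" "cball x e \<subseteq> interior I"
    using x open_interior open_contains_cball_eq by metis
  define a where "a = x - e"
  have a: "a < x" "{a..x} \<subseteq> interior I"
    using e by (auto simp: a_def subset_iff dist_real_def)
  then have aI: "{a..x} \<subseteq> I"
    using interior_subset by blast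
  \<comment> \<open>Finiteness matters as much as positivity: \<open>measure\<close> is
    \<open>0\<close> on a set of infinite mass, and this number is cancelled below.\<close>
  have meas: "0 < measure m {y<..x}" if "y \<in> {a<..<x}" for y
  proof -
    have "emeasure m {y<..<x} \<le> emeasure m {y<..x}" "emeasure m {y<..x} \<le> emeasure m {y..x}"
      by (auto intro!: emeasure_mono simp: sets_m)
    moreover have "0 < emeasure m {y<..<x}"
      using that aI by (intro pos) auto
    moreover have "emeasure m {y..x} < \<infinity>"
      using that aI by (intro fin) auto
    ultimately show ?thesis
      unfolding measure_def by (subst enn2real_positive_iff) (auto intro: less_le_trans le_less_trans)
  qed
  \<comment> \<open>Multiplying the speed quotient by the mass of \<open>(y, x]\<close> recovers
    \<open>?D y\<close>. Its left limit thus differs from \<open>?D x\<close> by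
    \<open>\<alpha> * u x\<close> times the atom of \<open>m\<close> at \<open>x\<close>.\<close>
  have "((\<lambda>y. ?D x - (?D x - ?D y) / measure m {y<..x} * measure m {y<..x})
      \<longlongrightarrow> ?D x - \<alpha> * u x * measure m {x}) (at_left x)"
    using has_feller_interior_left_quotient[OF alpha_harmonicD[OF u x]]
      measure_left_half_open_tendsto[OF a(1) sets_m fin[OF a(1) aI]]
    by (intro tendsto_intros)
  moreover have "\<forall>\<^sub>F y in at_left x.
      ?D x - (?D x - ?D y) / measure m {y<..x} * measure m {y<..x} = ?D y"
    using eventually_at_left_real[OF a(1)] by eventually_elim (use meas in fastforce)
  ultimately have "(?D \<longlongrightarrow> ?D x - \<alpha> * u x * measure m {x}) (at_left x)"
    by (rule Lim_transform_eventually)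
  then have "(?D \<longlongrightarrow> ?D x) (at_left x)"
    by (simp add: atom)
  then show ?thesis
  proof (rule scale_derivative_from_left[OF a(1), rotated 4])
    show "strict_mono_on {a..x} s"
      using s(1) aI by (rule monotone_on_subset)
    show "continuous_on {a..x} s" "continuous_on {a..x} u"
      using s(2) u aI by (auto simp: alpha_harmonic_def intro: continuous_on_subset)
    show "has_right_scale_derivative s u (?D y) y" if "a \<le> y" "y < x" for y
      using that a(2) by (intro alpha_harmonic_right_derivative[OF u]) auto
  qed
qed

section \<open>Chain rule and gluing for one-sided derivatives\<close>

lemma difference_quotient_chain:
  assumes "((\<lambda>y. (u y - u x) / (s y - s x)) \<longlongrightarrow> d) F" "((\<lambda>y. (s y - s x) / (y - x)) \<longlongrightarrow> e) F"
    and ne: "\<forall>\<^sub>F y in F. s y \<noteq> s x"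
  shows "((\<lambda>y. (u y - u x) / (y - x :: real)) \<longlongrightarrow> d * (e :: real)) F"
proof -
  have "\<forall>\<^sub>F y in F. (u y - u x) / (s y - s x) * ((s y - s x) / (y - x)) = (u y - u x) / (y - x)"
    using ne by eventually_elim simp
  with tendsto_mult[OF assms(1,2)] show ?thesis
    by (rule Lim_transform_eventually)
qed

lemma has_field_derivative_from_sides:
  fixes u :: "real \<Rightarrow> real"
  assumes "((\<lambda>y. (u y - u x) / (y - x)) \<longlongrightarrow> d) (at_left x)"
    "((\<lambda>y. (u y - u x) / (y - x)) \<longlongrightarrow> d) (at_right x)"
  shows "(u has_field_derivative d) (at x)"
  unfolding has_field_derivative_iff using assms by (rule filterlim_split_at)

lemma has_field_derivative_sides:
  fixes u :: "real \<Rightarrow> real"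
  assumes "(u has_field_derivative d) (at x)"
  shows "((\<lambda>y. (u y - u x) / (y - x)) \<longlongrightarrow> d) (at_left x)"
    "((\<lambda>y. (u y - u x) / (y - x)) \<longlongrightarrow> d) (at_right x)"
  using assms unfolding has_field_derivative_iff by (simp_all add: filterlim_at_split)

text \<open>On the right, \<open>v\<close> deviates from \<open>c * u\<close> by at most
  \<open>\<delta> y * \<epsilon> y\<close>, where \<open>\<delta>\<close> is \<open>O(y - x)\<close>
  and \<open>\<epsilon>\<close> tends to \<open>0\<close>. The deviation is \<open>o(y - x)\<close>,
  so the right derivative of \<open>v\<close> is that of \<open>c * u\<close>, as on the
  left.\<close>

lemma derivative_paste:
  fixes u v :: "real \<Rightarrow> real"
  assumes u: "(u has_field_derivative d) (at x)" and "v x = c * u x"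
    and left: "\<forall>\<^sub>F y in at_left x. v y = c * u y"
    and right: "\<forall>\<^sub>F y in at_right x. \<bar>c * u y - v y\<bar> \<le> \<delta> y * \<epsilon> y"
    and \<delta>: "((\<lambda>y. \<delta> y / (y - x)) \<longlongrightarrow> k) (at_right x)" and \<epsilon>: "(\<epsilon> \<longlongrightarrow> 0) (at_right x)"
  shows "(v has_field_derivative c * d) (at x)"
proof (rule has_field_derivative_from_sides)
  have cu: "((\<lambda>y. (c * u y - c * u x) / (y - x)) \<longlongrightarrow> c * d) (at_left x)"
    "((\<lambda>y. (c * u y - c * u x) / (y - x)) \<longlongrightarrow> c * d) (at_right x)"
    using has_field_derivative_sides[OF DERIV_cmult[OF u, of c]] by auto
  have "\<forall>\<^sub>F y in at_left x. (c * u y - c * u x) / (y - x) = (v y - v x) / (y - x)"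
    using left by eventually_elim (simp add: \<open>v x = c * u x\<close>)
  with cu(1) show "((\<lambda>y. (v y - v x) / (y - x)) \<longlongrightarrow> c * d) (at_left x)"
    by (rule Lim_transform_eventually)
  have "((\<lambda>y. (c * u y - v y) / (y - x)) \<longlongrightarrow> 0) (at_right x)"
  proof (rule Lim_null_comparison)
    show "\<forall>\<^sub>F y in at_right x. norm ((c * u y - v y) / (y - x)) \<le> \<delta> y / (y - x) * \<epsilon> y"
      using right eventually_at_right_less[of x]
      by eventually_elim (simp add: divide_right_mono)
    show "((\<lambda>y. \<delta> y / (y - x) * \<epsilon> y) \<longlongrightarrow> 0) (at_right x)"
      using tendsto_mult[OF \<delta> \<epsilon>] by simp
  qed
  from tendsto_diff[OF cu(2) this]
  show "((\<lambda>y. (v y - v x) / (y - x)) \<longlongrightarrow> c * d) (at_right x)"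
    by (simp add: \<open>v x = c * u x\<close> diff_divide_distrib[symmetric])
qed

section \<open>Hitting times and the strong Markov property\<close>

lemma space_natural_filtration [simp]: "space (natural_filtration \<Omega> X t) = \<Omega>"
  by (simp add: natural_filtration_def space_measure_of_conv)

lemma sets_natural_filtration:
  "sets (natural_filtration \<Omega> X t) =
     sigma_sets \<Omega> {X s -` B \<inter> \<Omega> | s B. 0 \<le> s \<and> ennreal s \<le> t \<and> B \<in> sets borel}"
  unfolding natural_filtration_def by (rule sets_measure_of) auto

lemma natural_filtration_measurable:
  assumes "0 \<le> s" "ennreal s \<le> t"
  shows "X s \<in> borel_measurable (natural_filtration \<Omega> X t)"
  using assms by (intro measurableI) (auto simp: sets_natural_filtration)

context diffusion
begin

abbreviation "F \<equiv> natural_filtration \<Omega> X \<infinity>"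

text \<open>By path continuity the times \<open>t \<ge> 0\<close> spent at \<open>z\<close> form a
  closed set bounded below, so the infimum defining the hitting time is a minimum once the set is
  nonempty.\<close>

lemma hitting_time_attained:
  assumes \<omega>: "\<omega> \<in> \<Omega>" and fin: "hitting_time X {z} \<omega> < \<infinity>"
  obtains t where "0 \<le> t" "X t \<omega> = z" "hitting_time X {z} \<omega> = ennreal t"
proof -
  define S where "S = {t. 0 \<le> t \<and> X t \<omega> = z}"
  have cl: "closed S"
  proof -
    have "closed ({0..} \<inter> (\<lambda>t. X t \<omega>) -` {z})"
      using paths[OF \<omega>] by (intro continuous_closed_preimage) auto
    also have "{0..} \<inter> (\<lambda>t. X t \<omega>) -` {z} = S"
      by (auto simp: S_def)
    finally show ?thesis .
  qed
  have ne: "S \<noteq> {}"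
  proof
    assume "S = {}"
    then have "{ennreal t |t. 0 \<le> t \<and> X t \<omega> \<in> {z}} = {}"
      by (auto simp: S_def)
    with fin show False
      by (simp only: hitting_time_def) simp
  qed
  have bdd: "bdd_below S"
    by (auto simp: S_def bdd_below_def)
  define t where "t = Inf S"
  have t: "t \<in> S"
    unfolding t_def using closed_contains_Inf ne bdd cl by blast
  have "hitting_time X {z} \<omega> = ennreal t"
    unfolding hitting_time_def
  proof (rule antisym)
    show "Inf {ennreal t |t. 0 \<le> t \<and> X t \<omega> \<in> {z}} \<le> ennreal t"
      using t by (intro Inf_lower) (auto simp: S_def)
    show "ennreal t \<le> Inf {ennreal t |t. 0 \<le> t \<and> X t \<omega> \<in> {z}}"
      using bdd by (intro Inf_greatest) (auto simp: S_def t_def intro!: ennreal_leI cInf_lower)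
  qed
  with t that show ?thesis
    by (auto simp: S_def)
qed

lemma hitting_time_le_iff:
  assumes \<omega>: "\<omega> \<in> \<Omega>" and "0 \<le> q"
  shows "hitting_time X {z} \<omega> \<le> ennreal q \<longleftrightarrow> (\<exists>t\<in>{0..q}. X t \<omega> = z)"
proof
  assume le: "hitting_time X {z} \<omega> \<le> ennreal q"
  then have "hitting_time X {z} \<omega> < \<infinity>"
    by (simp add: le_less_trans)
  then show "\<exists>t\<in>{0..q}. X t \<omega> = z"
    using le \<open>0 \<le> q\<close> by (elim hitting_time_attained[OF \<omega>]) (force simp: ennreal_le_iff)
next
  assume "\<exists>t\<in>{0..q}. X t \<omega> = z"
  then obtain t where t: "t \<in> {0..q}" "X t \<omega> = z"
    by blast
  then have "hitting_time X {z} \<omega> \<le> ennreal t"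
    unfolding hitting_time_def by (intro Inf_lower) auto
  also have "\<dots> \<le> ennreal q"
    using t by (auto intro: ennreal_leI)
  finally show "hitting_time X {z} \<omega> \<le> ennreal q" .
qed

text \<open>A continuous path meets \<open>z\<close> during \<open>[0, r]\<close> iff it comes
  arbitrarily close to \<open>z\<close> along a countable dense set of times. This leaves only
  countable operations on values of the process at times \<open>\<le> u\<close>.\<close>

lemma hitting_time_le_sets:
  assumes qu: "q \<le> u"
  shows "{\<omega>\<in>\<Omega>. hitting_time X {z} \<omega> \<le> q} \<in> sets (natural_filtration \<Omega> X u)"
proof (cases q)
  case top
  have "\<Omega> \<in> sets (natural_filtration \<Omega> X u)"
    using sets.top[of "natural_filtration \<Omega> X u"] by simp
  then show ?thesis
    by (simp add: top)
next
  case (real r)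
  obtain D where D: "countable D" "D \<subseteq> {0..r}" "{0..r} \<subseteq> closure D"
    using separable[of "{0..r}"] by blast
  have eq: "hitting_time X {z} \<omega> \<le> q \<longleftrightarrow> (\<forall>n::nat. \<exists>d\<in>D. \<bar>X d \<omega> - z\<bar> < 1 / Suc n)"
    if \<omega>: "\<omega> \<in> \<Omega>" for \<omega>
  proof -
    have cont: "continuous_on {0..r} (\<lambda>t. \<bar>X t \<omega> - z\<bar>)"
      using paths[OF \<omega>] by (intro continuous_intros) (auto intro: continuous_on_subset)
    have "(\<exists>t\<in>{0..r}. X t \<omega> = z) \<longleftrightarrow> (\<forall>n::nat. \<exists>d\<in>D. \<bar>X d \<omega> - z\<bar> < 1 / Suc n)"
    proof safe
      fix t n assume t: "t \<in> {0..r}" "z = X t \<omega>"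
      show "\<exists>d\<in>D. \<bar>X d \<omega> - X t \<omega>\<bar> < 1 / Suc n"
      proof (rule ccontr)
        assume *: "\<not> ?thesis"
        \<comment> \<open>If all times in \<open>D\<close> kept distance at least
          \<open>1 / Suc n\<close> from \<open>z\<close>, so would the closure of \<open>D\<close>,
          which contains \<open>t\<close>.\<close>
        have "closed ({0..r} \<inter> (\<lambda>u. \<bar>X u \<omega> - z\<bar>) -` {1 / Suc n..})"
          by (intro continuous_closed_preimage cont) auto
        moreover have "D \<subseteq> {0..r} \<inter> (\<lambda>u. \<bar>X u \<omega> - z\<bar>) -` {1 / Suc n..}"
          using * D(2) t by (auto simp: not_less)
        ultimately have "closure D \<subseteq> {0..r} \<inter> (\<lambda>u. \<bar>X u \<omega> - z\<bar>) -` {1 / Suc n..}"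
          by (rule closure_minimal[rotated])
        then have "t \<in> (\<lambda>u. \<bar>X u \<omega> - z\<bar>) -` {1 / Suc n..}"
          using D(3) t(1) by blast
        then show False
          unfolding t(2) by simp
      qed
    next
      assume *: "\<forall>n::nat. \<exists>d\<in>D. \<bar>X d \<omega> - z\<bar> < 1 / Suc n"
      have "{0..r} \<noteq> {}"
        using real by auto
      \<comment> \<open>The distance to \<open>z\<close> attains its minimum on the compact
        interval; closeness along \<open>D\<close> forces this minimum to be
        \<open>0\<close>.\<close>
      then obtain t where t: "t \<in> {0..r}" "\<And>u. u \<in> {0..r} \<Longrightarrow> \<bar>X t \<omega> - z\<bar> \<le> \<bar>X u \<omega> - z\<bar>"
        using continuous_attains_inf[OF _ _ cont] by auto
      have "\<bar>X t \<omega> - z\<bar> \<le> 0"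
      proof (rule ccontr)
        assume "\<not> ?thesis"
        then obtain n :: nat where "1 / Suc n < \<bar>X t \<omega> - z\<bar>"
          by (metis not_le nat_approx_posE)
        moreover obtain d where "d \<in> D" "\<bar>X d \<omega> - z\<bar> < 1 / Suc n"
          using * by blast
        ultimately show False
          using t(2)[of d] D(2) by auto
      qed
      then show "\<exists>t\<in>{0..r}. X t \<omega> = z"
        using t(1) by auto
    qed
    then show ?thesis
      using hitting_time_le_iff[OF \<omega>, of r z] real by simp
  qed
  have "{\<omega>\<in>space (natural_filtration \<Omega> X u). \<forall>n::nat. \<exists>d\<in>D. \<bar>X d \<omega> - z\<bar> < 1 / Suc n}
      \<in> sets (natural_filtration \<Omega> X u)"
  proof (intro sets.sets_Collect_countable_All sets.sets_Collect_countable_Ex' D(1))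
    fix d n assume "d \<in> D"
    then have "0 \<le> d" "ennreal d \<le> q"
      using D(2) real by (auto intro: ennreal_leI)
    then have [measurable]: "X d \<in> borel_measurable (natural_filtration \<Omega> X u)"
      using qu by (intro natural_filtration_measurable) (auto intro: order_trans)
    show "{\<omega>\<in>space (natural_filtration \<Omega> X u). \<bar>X d \<omega> - z\<bar> < 1 / Suc n}
        \<in> sets (natural_filtration \<Omega> X u)"
      by measurable
  qed
  also have "{\<omega>\<in>space (natural_filtration \<Omega> X u). \<forall>n::nat. \<exists>d\<in>D. \<bar>X d \<omega> - z\<bar> < 1 / Suc n} =
      {\<omega>\<in>\<Omega>. hitting_time X {z} \<omega> \<le> q}"
    using eq by auto
  finally show ?thesis .
qed

text \<open>The event is decided by time \<open>u\<close>, hence lies in each of the later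
  \<sigma>-algebras whose intersection makes up the right-continuous filtration.\<close>

lemma hitting_time_le_right_sets:
  assumes "q \<le> u"
  shows "{\<omega>\<in>\<Omega>. hitting_time X {z} \<omega> \<le> q} \<in> sets (right_filtration \<Omega> X u)"
proof -
  have "{\<omega>\<in>\<Omega>. hitting_time X {z} \<omega> \<le> q} \<in> (\<Inter>u\<in>{v. u < v \<or> v = \<infinity>}. sets (natural_filtration \<Omega> X u))"
    using assms by (auto intro!: hitting_time_le_sets)
  moreover have "(\<Inter>u\<in>{v. u < v \<or> v = \<infinity>}. sets (natural_filtration \<Omega> X u)) \<subseteq> Pow \<Omega>"
    using sets.sets_into_space[of _ F] by auto
  ultimately show ?thesis
    unfolding right_filtration_def by (simp add: sets_measure_of)
qed

lemma stopping_time_hitting_time: "stopping_time (right_filtration \<Omega> X) (hitting_time X {z})"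
  unfolding stopping_time_def
proof
  fix t
  show "Measurable.pred (right_filtration \<Omega> X t) (\<lambda>\<omega>. hitting_time X {z} \<omega> \<le> t)"
    using hitting_time_le_right_sets[of t t z]
    by (simp add: pred_def right_filtration_def space_measure_of_conv)
qed

lemma hitting_time_measurable [measurable]: "hitting_time X {z} \<in> borel_measurable F"
  using hitting_time_le_sets[of _ \<infinity> z] by (intro borel_measurableI_le) simp

text \<open>Sampling at the grid times \<open>\<lfloor>t (i + 1)\<rfloor> / (i + 1)\<close> involves
  countably many times only and converges by path continuity. The clamp \<open>max 0\<close> keeps
  the argument in \<open>[0, \<infinity>)\<close>, where continuity of the paths is known.\<close>

lemma process_measurable_pair:
  "(\<lambda>(t, \<omega>). X (max 0 t) \<omega>) \<in> borel_measurable (borel \<Otimes>\<^sub>M F)"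
proof (rule borel_measurable_LIMSEQ_real[where
      u = "\<lambda>(i::nat) (t::real, \<omega>). X (max 0 (of_int \<lfloor>t * real (Suc i)\<rfloor> / Suc i)) \<omega>"])
  fix i :: nat
  have "(\<lambda>x. (\<lambda>k x. X (max 0 (of_int k / Suc i)) (snd x)) \<lfloor>fst x * real (Suc i)\<rfloor> x)
      \<in> borel_measurable (borel \<Otimes>\<^sub>M F)"
  proof (rule measurable_compose_countable[where
        f = "\<lambda>k x. X (max 0 (of_int k / Suc i)) (snd x)" and g = "\<lambda>x. \<lfloor>fst x * real (Suc i)\<rfloor>"])
    fix k :: int
    have "X (max 0 (of_int k / Suc i)) \<in> borel_measurable F"
      by (rule natural_filtration_measurable) auto
    then show "(\<lambda>x. X (max 0 (of_int k / Suc i)) (snd x)) \<in> borel_measurable ((borel :: real measure) \<Otimes>\<^sub>M F)"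
      by measurable
  qed measurable
  then show "(\<lambda>(t::real, \<omega>). X (max 0 (of_int \<lfloor>t * real (Suc i)\<rfloor> / Suc i)) \<omega>) \<in> borel_measurable (borel \<Otimes>\<^sub>M F)"
    by (simp add: case_prod_beta)
next
  fix x assume "x \<in> space ((borel :: real measure) \<Otimes>\<^sub>M F)"
  then obtain t \<omega> where x: "x = (t, \<omega>)" "\<omega> \<in> \<Omega>"
    by (cases x) (auto simp: space_pair_measure)
  have "(\<lambda>i. of_int \<lfloor>t * real (Suc i)\<rfloor> / Suc i) \<longlonglongrightarrow> t"
  proof (rule LIM_zero_cancel, rule Lim_null_comparison)
    have "\<bar>of_int \<lfloor>t * real (Suc i)\<rfloor> / Suc i - t\<bar> \<le> inverse (real (Suc i))" for i
    proof -
      have "\<bar>of_int \<lfloor>t * real (Suc i)\<rfloor> - t * real (Suc i)\<bar> \<le> 1"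
        by linarith
      moreover have "of_int \<lfloor>t * real (Suc i)\<rfloor> / Suc i - t = (of_int \<lfloor>t * real (Suc i)\<rfloor> - t * real (Suc i)) / Suc i"
        by (simp add: field_simps)
      ultimately show ?thesis
        by (simp add: abs_divide divide_simps del: of_nat_Suc)
    qed
    then show "\<forall>\<^sub>F i in sequentially. norm (of_int \<lfloor>t * real (Suc i)\<rfloor> / Suc i - t) \<le> inverse (real (Suc i))"
      by simp
  qed (rule LIMSEQ_inverse_real_of_nat)
  then have "(\<lambda>i. max 0 (of_int \<lfloor>t * real (Suc i)\<rfloor> / Suc i)) \<longlonglongrightarrow> max 0 t"
    by (intro tendsto_max tendsto_const)
  then have "(\<lambda>i. X (max 0 (of_int \<lfloor>t * real (Suc i)\<rfloor> / Suc i)) \<omega>) \<longlonglongrightarrow> X (max 0 t) \<omega>"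
    using paths[OF x(2)] by (intro continuous_on_tendsto_compose[of "{0..}" "\<lambda>t. X t \<omega>"]) auto
  then show "(\<lambda>i. (\<lambda>(i::nat) (t::real, \<omega>). X (max 0 (of_int \<lfloor>t * real (Suc i)\<rfloor> / Suc i)) \<omega>) i x)
      \<longlonglongrightarrow> (case x of (t, \<omega>) \<Rightarrow> X (max 0 t) \<omega>)"
    by (simp add: x)
qed

end

text \<open>Writing the discount factor as a mixture of indicators of \<open>\<tau> \<le> q\<close> reduces discounted expectations to
  the strong Markov property for events.\<close>

lemma discount_eq_nn_integral:
  assumes "0 < \<alpha>"
  shows "discount \<alpha> \<tau> =
    (\<integral>\<^sup>+q. ennreal (\<alpha> * exp (- \<alpha> * q)) * indicator {q. 0 \<le> q \<and> \<tau> \<le> ennreal q} q \<partial>lborel)"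
proof (cases \<tau>)
  case top
  then show ?thesis
    by (simp add: discount_def top_unique)
next
  case (real t)
  have "((\<lambda>q. - exp (- \<alpha> * q)) \<longlongrightarrow> - 0) at_top"
    using assms
    by (intro tendsto_minus filterlim_compose[OF exp_at_bot] filterlim_tendsto_neg_mult_at_bot[OF tendsto_const])
      (auto simp: filterlim_ident)
  then have "(\<integral>\<^sup>+q. ennreal (\<alpha> * exp (- \<alpha> * q)) * indicator {t..} q \<partial>lborel) = ennreal (- 0 - - exp (- \<alpha> * t))"
    using assms by (intro nn_integral_FTC_atLeast) (auto intro!: derivative_eq_intros)
  moreover have "{q. 0 \<le> q \<and> \<tau> \<le> ennreal q} = {t..}"
    using real by (auto simp: ennreal_le_iff)
  ultimately show ?thesis
    using real by (simp add: discount_def)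
qed

section \<open>The discounted strong Markov property and occupation measures\<close>

context diffusion
begin

lemma process_sets:
  assumes "0 \<le> t" "B \<in> sets borel"
  shows "{\<omega>\<in>\<Omega>. X t \<omega> \<in> B} \<in> sets F"
proof -
  have [measurable]: "X t \<in> borel_measurable F"
    using assms by (intro natural_filtration_measurable) auto
  have "{\<omega>\<in>space F. X t \<omega> \<in> B} \<in> sets F"
    using assms by measurable
  then show ?thesis
    by simp
qed

text \<open>At the hitting time of \<open>z\<close> the process is at \<open>z\<close>, so the inner
  probability in the strong Markov property is the same for all paths in
  \<open>A = {T \<le> q}\<close> and comes out of the integral.\<close>

lemma strong_markov_hitting_time:
  assumes x: "x \<in> I" and "0 \<le> q" "0 \<le> u" and B: "B \<in> sets borel"
  shows "emeasure (P x) {\<omega>\<in>\<Omega>. hitting_time X {z} \<omega> \<le> ennreal q \<and>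
           X (enn2real (hitting_time X {z} \<omega>) + u) \<omega> \<in> B} =
         emeasure (P x) {\<omega>\<in>\<Omega>. hitting_time X {z} \<omega> \<le> ennreal q} * emeasure (P z) {\<omega>\<in>\<Omega>. X u \<omega> \<in> B}"
proof -
  define T where "T = hitting_time X {z}"
  define A where "A = {\<omega>\<in>\<Omega>. T \<omega> \<le> ennreal q}"
  have fin: "T \<omega> < \<infinity>" if "\<omega> \<in> A" for \<omega>
    using that by (auto simp: A_def intro: le_less_trans)
  have XT: "X (enn2real (T \<omega>)) \<omega> = z" if "\<omega> \<in> A" for \<omega>
  proof -
    have "\<omega> \<in> \<Omega>"
      using that by (simp add: A_def)
    then show ?thesis
      using fin[OF that] unfolding T_def by (elim hitting_time_attained) auto
  qed
  have A: "A \<in> sets F"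
    using hitting_time_le_sets[of "ennreal q" \<infinity> z] by (simp add: A_def T_def)
  \<comment> \<open>Intersecting \<open>A\<close> with \<open>T \<le> t\<close> gives the hitting
    event with time bound \<open>min q t\<close>; hence \<open>A\<close> belongs to the past of
    \<open>T\<close>.\<close>
  have "{\<omega>\<in>A. T \<omega> \<le> t} \<in> sets (right_filtration \<Omega> X t)" for t
  proof -
    have "{\<omega>\<in>A. T \<omega> \<le> t} = {\<omega>\<in>\<Omega>. hitting_time X {z} \<omega> \<le> min (ennreal q) t}"
      by (auto simp: A_def T_def)
    then show ?thesis
      by (simp only:) (rule hitting_time_le_right_sets, simp)
  qed
  then have "emeasure (P x) {\<omega>\<in>A. T \<omega> < \<infinity> \<and> X (enn2real (T \<omega>) + u) \<omega> \<in> B} =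
      (\<integral>\<^sup>+\<omega>\<in>{\<omega>\<in>A. T \<omega> < \<infinity>}. emeasure (P (X (enn2real (T \<omega>)) \<omega>)) {\<omega>'\<in>\<Omega>. X u \<omega>' \<in> B} \<partial>P x)"
    using assms by (intro strong_markov) (auto simp: T_def stopping_time_hitting_time)
  also have "\<dots> = (\<integral>\<^sup>+\<omega>. emeasure (P z) {\<omega>'\<in>\<Omega>. X u \<omega>' \<in> B} * indicator A \<omega> \<partial>P x)"
    by (intro nn_integral_cong) (auto simp: XT fin[simplified] indicator_def)
  also have "\<dots> = emeasure (P x) A * emeasure (P z) {\<omega>\<in>\<Omega>. X u \<omega> \<in> B}"
    using A by (subst nn_integral_cmult_indicator) (simp_all add: sets_P[OF x] mult.commute)
  also have "{\<omega>\<in>A. T \<omega> < \<infinity> \<and> X (enn2real (T \<omega>) + u) \<omega> \<in> B} =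
      {\<omega>\<in>\<Omega>. T \<omega> \<le> ennreal q \<and> X (enn2real (T \<omega>) + u) \<omega> \<in> B}"
    using fin by (auto simp: A_def)
  finally show ?thesis
    by (simp add: A_def T_def)
qed

lemma process_at_random_time_measurable [measurable]:
  assumes [measurable]: "f \<in> borel_measurable N" "g \<in> N \<rightarrow>\<^sub>M F"
  shows "(\<lambda>y. X (max 0 (f y)) (g y)) \<in> borel_measurable N"
proof -
  have "(\<lambda>y. (f y, g y)) \<in> N \<rightarrow>\<^sub>M borel \<Otimes>\<^sub>M F"
    by measurable
  from measurable_compose[OF this process_measurable_pair] show ?thesis
    by simp
qed

text \<open>The identity for the events \<open>T \<le> q\<close> is integrated over
  \<open>q \<ge> 0\<close> against \<open>\<alpha> exp (- \<alpha> q) dq\<close>, which turns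
  probabilities of these events into expected discount factors.\<close>

lemma discounted_strong_markov:
  assumes x: "x \<in> I" and "0 < \<alpha>" "0 \<le> u" and B [measurable]: "B \<in> sets borel"
  shows "(\<integral>\<^sup>+\<omega>. discount \<alpha> (hitting_time X {z} \<omega>) *
            indicator B (X (enn2real (hitting_time X {z} \<omega>) + u) \<omega>) \<partial>P x) =
         (\<integral>\<^sup>+\<omega>. discount \<alpha> (hitting_time X {z} \<omega>) \<partial>P x) * emeasure (P z) {\<omega>\<in>\<Omega>. X u \<omega> \<in> B}"
proof -
  interpret prob_space "P x"
    using x by (rule prob)
  interpret PL: pair_sigma_finite "P x" lborel
    by unfold_locales
  have [measurable_cong]: "sets (P x) = sets F"
    using x by (rule sets_P)
  define T where "T = hitting_time X {z}"
  have [measurable]: "T \<in> borel_measurable F"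
    unfolding T_def by (rule hitting_time_measurable)
  define c where "c = (\<lambda>q. ennreal (\<alpha> * exp (- \<alpha> * q)) * indicator {0..} q)"
  have [measurable]: "c \<in> borel_measurable borel"
    unfolding c_def by measurable
  \<comment> \<open>Proved for every \<open>C\<close>: the choice \<open>C = B\<close> treats the
    left-hand side, the choice \<open>C = UNIV\<close> the plain expected discount on the
    right.\<close>
  have layer: "(\<integral>\<^sup>+\<omega>. discount \<alpha> (T \<omega>) * indicator C (X (enn2real (T \<omega>) + u) \<omega>) \<partial>P x) =
      (\<integral>\<^sup>+q. c q * emeasure (P x) {\<omega>\<in>\<Omega>. T \<omega> \<le> ennreal q \<and> X (enn2real (T \<omega>) + u) \<omega> \<in> C} \<partial>lborel)"
    if [measurable]: "C \<in> sets borel" for C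
  proof -
    have XT [simp]: "max 0 (enn2real (T \<omega>) + u) = enn2real (T \<omega>) + u" for \<omega>
      using \<open>0 \<le> u\<close> by (simp add: max_def)
    have XT_meas [measurable]: "(\<lambda>\<omega>. X (enn2real (T \<omega>) + u) \<omega>) \<in> borel_measurable F"
    proof -
      have "(\<lambda>\<omega>. X (max 0 (enn2real (T \<omega>) + u)) \<omega>) \<in> borel_measurable F"
        by measurable
      then show ?thesis
        by (simp only: XT)
    qed
    have "(\<integral>\<^sup>+\<omega>. discount \<alpha> (T \<omega>) * indicator C (X (enn2real (T \<omega>) + u) \<omega>) \<partial>P x) =
        (\<integral>\<^sup>+\<omega>. (\<integral>\<^sup>+q. c q * indicator {\<omega>. T \<omega> \<le> ennreal q} \<omega> * indicator C (X (enn2real (T \<omega>) + u) \<omega>) \<partial>lborel) \<partial>P x)"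
    proof (intro nn_integral_cong)
      fix \<omega>
      have "discount \<alpha> (T \<omega>) = (\<integral>\<^sup>+q. c q * indicator {\<omega>. T \<omega> \<le> ennreal q} \<omega> \<partial>lborel)"
        unfolding discount_eq_nn_integral[OF \<open>0 < \<alpha>\<close>] c_def
        by (intro nn_integral_cong) (auto simp: indicator_def)
      then show "discount \<alpha> (T \<omega>) * indicator C (X (enn2real (T \<omega>) + u) \<omega>) =
          (\<integral>\<^sup>+q. c q * indicator {\<omega>. T \<omega> \<le> ennreal q} \<omega> * indicator C (X (enn2real (T \<omega>) + u) \<omega>) \<partial>lborel)"
        by (auto simp: indicator_def)
    qed
    also have "\<dots> = (\<integral>\<^sup>+q. (\<integral>\<^sup>+\<omega>. c q * indicator {\<omega>. T \<omega> \<le> ennreal q} \<omega> * indicator C (X (enn2real (T \<omega>) + u) \<omega>) \<partial>P x) \<partial>lborel)"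
      by (rule PL.Fubini'[symmetric]) measurable
    also have "\<dots> = (\<integral>\<^sup>+q. c q * emeasure (P x) {\<omega>\<in>\<Omega>. T \<omega> \<le> ennreal q \<and> X (enn2real (T \<omega>) + u) \<omega> \<in> C} \<partial>lborel)"
    proof (intro nn_integral_cong)
      fix q :: real
      have "{\<omega>\<in>space F. T \<omega> \<le> ennreal q \<and> X (enn2real (T \<omega>) + u) \<omega> \<in> C} \<in> sets F"
        by measurable
      then have *: "{\<omega>\<in>\<Omega>. T \<omega> \<le> ennreal q \<and> X (enn2real (T \<omega>) + u) \<omega> \<in> C} \<in> sets (P x)"
        by (simp add: sets_P[OF x])
      have "(\<integral>\<^sup>+\<omega>. c q * indicator {\<omega>. T \<omega> \<le> ennreal q} \<omega> * indicator C (X (enn2real (T \<omega>) + u) \<omega>) \<partial>P x) =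
          (\<integral>\<^sup>+\<omega>. c q * indicator {\<omega>\<in>\<Omega>. T \<omega> \<le> ennreal q \<and> X (enn2real (T \<omega>) + u) \<omega> \<in> C} \<omega> \<partial>P x)"
        by (intro nn_integral_cong) (auto simp: indicator_def space_P[OF x])
      then show "(\<integral>\<^sup>+\<omega>. c q * indicator {\<omega>. T \<omega> \<le> ennreal q} \<omega> * indicator C (X (enn2real (T \<omega>) + u) \<omega>) \<partial>P x) =
          c q * emeasure (P x) {\<omega>\<in>\<Omega>. T \<omega> \<le> ennreal q \<and> X (enn2real (T \<omega>) + u) \<omega> \<in> C}"
        using * by (simp add: nn_integral_cmult_indicator)
    qed
    finally show ?thesis .
  qed
  have [measurable]: "(\<lambda>q. emeasure (P x) {\<omega>\<in>\<Omega>. T \<omega> \<le> ennreal q}) \<in> borel_measurable borel"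
  proof -
    have "(\<lambda>q. \<integral>\<^sup>+\<omega>. indicator {\<omega>. T \<omega> \<le> ennreal q} \<omega> \<partial>P x) \<in> borel_measurable borel"
      by measurable
    moreover have "(\<integral>\<^sup>+\<omega>. indicator {\<omega>. T \<omega> \<le> ennreal q} \<omega> \<partial>P x) = emeasure (P x) {\<omega>\<in>\<Omega>. T \<omega> \<le> ennreal q}" for q
    proof -
      have "(\<integral>\<^sup>+\<omega>. indicator {\<omega>. T \<omega> \<le> ennreal q} \<omega> \<partial>P x) =
          (\<integral>\<^sup>+\<omega>. indicator {\<omega>\<in>\<Omega>. T \<omega> \<le> ennreal q} \<omega> \<partial>P x)"
        by (intro nn_integral_cong) (auto simp: space_P[OF x] indicator_def)
      then show ?thesis
        using hitting_time_le_sets[of "ennreal q" \<infinity> z] by (simp add: sets_P[OF x] T_def)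
    qed
    ultimately show ?thesis
      by simp
  qed
  have "(\<integral>\<^sup>+\<omega>. discount \<alpha> (T \<omega>) * indicator B (X (enn2real (T \<omega>) + u) \<omega>) \<partial>P x) =
      (\<integral>\<^sup>+q. c q * emeasure (P x) {\<omega>\<in>\<Omega>. T \<omega> \<le> ennreal q} * emeasure (P z) {\<omega>\<in>\<Omega>. X u \<omega> \<in> B} \<partial>lborel)"
    unfolding layer[OF B]
    by (intro nn_integral_cong)
      (auto simp: c_def T_def strong_markov_hitting_time x B \<open>0 \<le> u\<close> indicator_def mult.assoc)
  also have "\<dots> = (\<integral>\<^sup>+q. c q * emeasure (P x) {\<omega>\<in>\<Omega>. T \<omega> \<le> ennreal q} \<partial>lborel) * emeasure (P z) {\<omega>\<in>\<Omega>. X u \<omega> \<in> B}"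
    by (rule nn_integral_multc) measurable
  also have "(\<integral>\<^sup>+q. c q * emeasure (P x) {\<omega>\<in>\<Omega>. T \<omega> \<le> ennreal q} \<partial>lborel) = (\<integral>\<^sup>+\<omega>. discount \<alpha> (T \<omega>) \<partial>P x)"
    using layer[of UNIV] by simp
  finally show ?thesis
    by (simp add: T_def)
qed

text \<open>The \<alpha>-resolvent of the indicator of \<open>B\<close>, that is the expected
  discounted time spent in \<open>B\<close> from the start at \<open>x\<close>. The Lebesgue-null
  time \<open>0\<close> is left out, since a transition density is given only for positive
  times.\<close>

definition occupation :: "real \<Rightarrow> real \<Rightarrow> real set \<Rightarrow> ennreal" where
  "occupation \<alpha> x B =
     (\<integral>\<^sup>+t. ennreal (exp (- \<alpha> * t)) * indicator {0<..} t * emeasure (P x) {\<omega>\<in>\<Omega>. X t \<omega> \<in> B} \<partial>lborel)"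

lemma emeasure_process:
  assumes x: "x \<in> I" and "0 \<le> t" and "B \<in> sets borel"
  shows "emeasure (P x) {\<omega>\<in>\<Omega>. X t \<omega> \<in> B} = (\<integral>\<^sup>+\<omega>. indicator B (X (max 0 t) \<omega>) \<partial>P x)"
proof -
  have "(\<integral>\<^sup>+\<omega>. indicator B (X (max 0 t) \<omega>) \<partial>P x) = (\<integral>\<^sup>+\<omega>. indicator {\<omega>\<in>\<Omega>. X t \<omega> \<in> B} \<omega> \<partial>P x)"
    using assms by (intro nn_integral_cong) (auto simp: space_P[OF x] indicator_def max_def)
  then show ?thesis
    using process_sets[of t B] assms by (simp add: sets_P[OF x])
qed

lemma occupation_eq_path_integral:
  assumes x: "x \<in> I" and [measurable]: "B \<in> sets borel"
  shows "occupation \<alpha> x B = (\<integral>\<^sup>+\<omega>. (\<integral>\<^sup>+t. ennreal (exp (- \<alpha> * t)) * indicator {0<..} t *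
           indicator B (X (max 0 t) \<omega>) \<partial>lborel) \<partial>P x)"
proof -
  interpret prob_space "P x"
    using x by (rule prob)
  interpret PL: pair_sigma_finite "P x" lborel
    by unfold_locales
  have [measurable_cong]: "sets (P x) = sets F"
    using x by (rule sets_P)
  have "occupation \<alpha> x B = (\<integral>\<^sup>+t. (\<integral>\<^sup>+\<omega>. ennreal (exp (- \<alpha> * t)) * indicator {0<..} t *
           indicator B (X (max 0 t) \<omega>) \<partial>P x) \<partial>lborel)"
    unfolding occupation_def
  proof (intro nn_integral_cong)
    fix t :: real
    show "ennreal (exp (- \<alpha> * t)) * indicator {0<..} t * emeasure (P x) {\<omega>\<in>\<Omega>. X t \<omega> \<in> B} =
        (\<integral>\<^sup>+\<omega>. ennreal (exp (- \<alpha> * t)) * indicator {0<..} t * indicator B (X (max 0 t) \<omega>) \<partial>P x)"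
    proof (cases "0 < t")
      case True
      have "(\<integral>\<^sup>+\<omega>. c * indicator B (X (max 0 t) \<omega>) \<partial>P x) =
          c * (\<integral>\<^sup>+\<omega>. indicator B (X (max 0 t) \<omega>) \<partial>P x)" for c
        by (rule nn_integral_cmult) measurable
      then show ?thesis
        using emeasure_process[OF x _ assms(2), of t] True by simp
    qed simp
  qed
  also have "\<dots> = (\<integral>\<^sup>+\<omega>. (\<integral>\<^sup>+t. ennreal (exp (- \<alpha> * t)) * indicator {0<..} t *
           indicator B (X (max 0 t) \<omega>) \<partial>lborel) \<partial>P x)"
    by (rule PL.Fubini') measurable
  finally show ?thesis .
qed

text \<open>For the time spent in \<open>B\<close> after the first visit to \<open>z\<close>, the
  substitution \<open>t = T + u\<close> splits off the factor \<open>exp (- \<alpha> T)\<close>; the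
  discounted strong Markov property then replaces the shifted process by one started at
  \<open>z\<close>.\<close>

lemma occupation_after_hitting:
  assumes x: "x \<in> I" and \<alpha>: "0 < \<alpha>" and z: "z \<in> I" and B [measurable]: "B \<in> sets borel"
  shows "(\<integral>\<^sup>+\<omega>. (\<integral>\<^sup>+t. ennreal (exp (- \<alpha> * t)) * indicator {t. hitting_time X {z} \<omega> < ennreal t} t *
             indicator B (X (max 0 t) \<omega>) \<partial>lborel) \<partial>P x) =
         (\<integral>\<^sup>+\<omega>. discount \<alpha> (hitting_time X {z} \<omega>) \<partial>P x) * occupation \<alpha> z B"
proof -
  interpret prob_space "P x"
    using x by (rule prob)
  interpret PL: pair_sigma_finite "P x" lborel
    by unfold_locales
  have [measurable_cong]: "sets (P x) = sets F"
    using x by (rule sets_P)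
  define T where "T = hitting_time X {z}"
  have [measurable]: "T \<in> borel_measurable F"
    unfolding T_def by (rule hitting_time_measurable)
  have [measurable]: "(\<lambda>\<omega>. discount \<alpha> (T \<omega>)) \<in> borel_measurable F"
    unfolding discount_def by measurable
  have shift: "(\<integral>\<^sup>+t. ennreal (exp (- \<alpha> * t)) * indicator {t. T \<omega> < ennreal t} t *
             indicator B (X (max 0 t) \<omega>) \<partial>lborel) =
      (\<integral>\<^sup>+u. ennreal (exp (- \<alpha> * u)) * indicator {0<..} u *
        (discount \<alpha> (T \<omega>) * indicator B (X (max 0 (enn2real (T \<omega>) + u)) \<omega>)) \<partial>lborel)"
    if "\<omega> \<in> \<Omega>" for \<omega>
  proof (cases "T \<omega>")
    \<comment> \<open>No time exceeds an infinite \<open>T\<close>, and \<open>discount\<close> is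
      \<open>0\<close> there, so both sides vanish.\<close>
    case top
    then show ?thesis
      by (simp add: discount_def)
  next
    case (real r)
    have X [measurable]: "(\<lambda>t. X (max 0 t) \<omega>) \<in> borel_measurable borel"
      using that by (intro process_at_random_time_measurable) auto
    have *: "{t. T \<omega> < ennreal t} = {r<..}"
      using real by (auto simp: ennreal_less_iff)
    show ?thesis
      unfolding * using real
      by (subst nn_integral_real_affine[where c = 1 and t = r])
        (auto intro!: nn_integral_cong simp: discount_def indicator_def exp_add[symmetric]
          ennreal_mult[symmetric] algebra_simps)
  qed
  have "(\<integral>\<^sup>+\<omega>. (\<integral>\<^sup>+t. ennreal (exp (- \<alpha> * t)) * indicator {t. T \<omega> < ennreal t} t *
             indicator B (X (max 0 t) \<omega>) \<partial>lborel) \<partial>P x) =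
      (\<integral>\<^sup>+\<omega>. (\<integral>\<^sup>+u. ennreal (exp (- \<alpha> * u)) * indicator {0<..} u *
        (discount \<alpha> (T \<omega>) * indicator B (X (max 0 (enn2real (T \<omega>) + u)) \<omega>)) \<partial>lborel) \<partial>P x)"
    by (intro nn_integral_cong shift) (simp add: space_P[OF x])
  also have "\<dots> = (\<integral>\<^sup>+u. (\<integral>\<^sup>+\<omega>. ennreal (exp (- \<alpha> * u)) * indicator {0<..} u *
        (discount \<alpha> (T \<omega>) * indicator B (X (max 0 (enn2real (T \<omega>) + u)) \<omega>)) \<partial>P x) \<partial>lborel)"
    by (rule PL.Fubini'[symmetric]) measurable
  also have "\<dots> = (\<integral>\<^sup>+u. (\<integral>\<^sup>+\<omega>. discount \<alpha> (T \<omega>) \<partial>P x) * (ennreal (exp (- \<alpha> * u)) * indicator {0<..} u *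
        emeasure (P z) {\<omega>\<in>\<Omega>. X u \<omega> \<in> B}) \<partial>lborel)"
  proof (intro nn_integral_cong)
    fix u :: real
    show "(\<integral>\<^sup>+\<omega>. ennreal (exp (- \<alpha> * u)) * indicator {0<..} u *
        (discount \<alpha> (T \<omega>) * indicator B (X (max 0 (enn2real (T \<omega>) + u)) \<omega>)) \<partial>P x) =
      (\<integral>\<^sup>+\<omega>. discount \<alpha> (T \<omega>) \<partial>P x) * (ennreal (exp (- \<alpha> * u)) * indicator {0<..} u *
        emeasure (P z) {\<omega>\<in>\<Omega>. X u \<omega> \<in> B})"
    proof (cases "0 < u")
      case True
      then have "max 0 (enn2real (T \<omega>) + u) = enn2real (T \<omega>) + u" for \<omega>
        by (simp add: max_def add_nonneg_nonneg)
      moreover have "(\<integral>\<^sup>+\<omega>. c * (discount \<alpha> (T \<omega>) * indicator B (X (max 0 (enn2real (T \<omega>) + u)) \<omega>)) \<partial>P x) =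
          c * (\<integral>\<^sup>+\<omega>. discount \<alpha> (T \<omega>) * indicator B (X (max 0 (enn2real (T \<omega>) + u)) \<omega>) \<partial>P x)" for c
        by (rule nn_integral_cmult) measurable
      ultimately show ?thesis
        using True discounted_strong_markov[OF x \<alpha>, of u B z] by (simp add: T_def mult_ac)
    qed simp
  qed
  also have "\<dots> = (\<integral>\<^sup>+\<omega>. discount \<alpha> (T \<omega>) \<partial>P x) * occupation \<alpha> z B"
    unfolding occupation_def
  proof (rule nn_integral_cmult)
    interpret Pz: prob_space "P z"
      using z by (rule prob)
    have [measurable_cong]: "sets (P z) = sets F"
      using z by (rule sets_P)
    \<comment> \<open>Measurability in \<open>u\<close> is read off from the integral of a jointly
      measurable function, which equals the probability for \<open>u > 0\<close>.\<close>
    have "(\<lambda>u. ennreal (exp (- \<alpha> * u)) * indicator {0<..} u * (\<integral>\<^sup>+\<omega>. indicator B (X (max 0 u) \<omega>) \<partial>P z))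
        \<in> borel_measurable lborel"
      by measurable
    also have "(\<lambda>u. ennreal (exp (- \<alpha> * u)) * indicator {0<..} u * (\<integral>\<^sup>+\<omega>. indicator B (X (max 0 u) \<omega>) \<partial>P z)) =
        (\<lambda>u. ennreal (exp (- \<alpha> * u)) * indicator {0<..} u * emeasure (P z) {\<omega>\<in>\<Omega>. X u \<omega> \<in> B})"
      using emeasure_process[OF z _ B] by (auto simp: fun_eq_iff indicator_def)
    finally show "(\<lambda>u. ennreal (exp (- \<alpha> * u)) * indicator {0<..} u * emeasure (P z) {\<omega>\<in>\<Omega>. X u \<omega> \<in> B})
        \<in> borel_measurable lborel" .
  qed
  finally show ?thesis
    by (simp add: T_def)
qed

text \<open>Dropping the time spent in \<open>B\<close> up to the first visit to \<open>z\<close>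
  can only decrease the occupation.\<close>

lemma occupation_ge:
  assumes "x \<in> I" "0 < \<alpha>" "z \<in> I" "B \<in> sets borel"
  shows "(\<integral>\<^sup>+\<omega>. discount \<alpha> (hitting_time X {z} \<omega>) \<partial>P x) * occupation \<alpha> z B \<le> occupation \<alpha> x B"
proof -
  have "0 < t" if "y < ennreal t" for y t
    using that by (rule contrapos_pp) (simp add: ennreal_neg not_less)
  then show ?thesis
    unfolding occupation_after_hitting[OF assms, symmetric]
      occupation_eq_path_integral[OF assms(1,4)]
    by (intro nn_integral_mono mult_right_mono mult_left_mono) (auto simp: indicator_def)
qed

text \<open>By the intermediate value theorem a path started at \<open>x \<le> z\<close> passes
  \<open>z\<close> before it can be in \<open>B\<close>, so nothing is lost in the estimate
  \<open>occupation_ge\<close>.\<close>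

lemma occupation_eq:
  assumes x: "x \<in> I" and \<alpha>: "0 < \<alpha>" and z: "z \<in> I" and B: "B \<in> sets borel"
    and "x \<le> z" "B \<subseteq> {z<..}"
  shows "occupation \<alpha> x B = (\<integral>\<^sup>+\<omega>. discount \<alpha> (hitting_time X {z} \<omega>) \<partial>P x) * occupation \<alpha> z B"
  unfolding occupation_after_hitting[OF x \<alpha> z B, symmetric] occupation_eq_path_integral[OF x B]
proof (intro nn_integral_cong_AE)
  show "AE \<omega> in P x. (\<integral>\<^sup>+t. ennreal (exp (- \<alpha> * t)) * indicator {0<..} t * indicator B (X (max 0 t) \<omega>) \<partial>lborel) =
      (\<integral>\<^sup>+t. ennreal (exp (- \<alpha> * t)) * indicator {t. hitting_time X {z} \<omega> < ennreal t} t *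
             indicator B (X (max 0 t) \<omega>) \<partial>lborel)"
    using start[OF x] AE_space
  proof eventually_elim
    case (elim \<omega>)
    have \<omega>: "\<omega> \<in> \<Omega>"
      using elim space_P[OF x] by simp
    have hit: "hitting_time X {z} \<omega> < ennreal t" if t: "0 < t" "X t \<omega> \<in> B" for t
    proof -
      have "X 0 \<omega> \<le> z" "z \<le> X t \<omega>"
        using elim t assms by auto
      moreover have "continuous_on {0..t} (\<lambda>t. X t \<omega>)"
        using paths[OF \<omega>] by (rule continuous_on_subset) auto
      ultimately obtain u where u: "0 \<le> u" "u \<le> t" "X u \<omega> = z"
        using IVT'[of "\<lambda>t. X t \<omega>" 0 z t] t by auto
      \<comment> \<open>The visit to \<open>z\<close> strictly precedes \<open>t\<close>, as needed
        because only times after the hitting time are counted: \<open>X t \<omega>\<close> is in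
        \<open>B\<close>, strictly to the right of \<open>z\<close>.\<close>
      moreover have "u \<noteq> t"
        using u t assms by auto
      ultimately have "hitting_time X {z} \<omega> \<le> ennreal u" "ennreal u < ennreal t"
        using hitting_time_le_iff[OF \<omega>, of u z] by (auto simp: ennreal_less_iff)
      then show ?thesis
        by (rule le_less_trans)
    qed
    show ?case
    proof (intro nn_integral_cong)
      fix t :: real
      show "ennreal (exp (- \<alpha> * t)) * indicator {0<..} t * indicator B (X (max 0 t) \<omega>) =
          ennreal (exp (- \<alpha> * t)) * indicator {t. hitting_time X {z} \<omega> < ennreal t} t *
             indicator B (X (max 0 t) \<omega>)"
        using hit[of t] by (cases "0 < t") (auto simp: indicator_def ennreal_neg)
    qed
  qed
qed

end

section \<open>The Green function\<close>

text \<open>The inequality is tested on the set \<open>B\<close> where \<open>h < f\<close>. By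
  finiteness the integrals may be subtracted, so \<open>f - h\<close>, positive on \<open>B\<close>,
  has integral \<open>0\<close> over \<open>B\<close>, and \<open>B\<close> is null.\<close>

lemma AE_le_of_set_nn_integral_le:
  fixes f h :: "'a \<Rightarrow> ennreal"
  assumes [measurable]: "f \<in> borel_measurable M" "h \<in> borel_measurable M"
    and fin: "(\<integral>\<^sup>+y. f y \<partial>M) < \<infinity>"
    and le: "\<And>B. B \<in> sets M \<Longrightarrow> (\<integral>\<^sup>+y\<in>B. f y \<partial>M) \<le> (\<integral>\<^sup>+y\<in>B. h y \<partial>M)"
  shows "AE y in M. f y \<le> h y"
proof -
  define B where "B = {y\<in>space M. h y < f y}"
  have [measurable]: "B \<in> sets M"
    unfolding B_def by measurable
  have "(\<integral>\<^sup>+y. h y * indicator B y \<partial>M) \<le> (\<integral>\<^sup>+y. f y \<partial>M)"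
    by (intro nn_integral_mono) (auto simp: B_def indicator_def)
  with fin have finh: "(\<integral>\<^sup>+y. h y * indicator B y \<partial>M) \<noteq> \<infinity>"
    by auto
  have "(\<integral>\<^sup>+y. f y * indicator B y - h y * indicator B y \<partial>M) =
      (\<integral>\<^sup>+y. f y * indicator B y \<partial>M) - (\<integral>\<^sup>+y. h y * indicator B y \<partial>M)"
    using finh by (intro nn_integral_diff) (auto simp: B_def indicator_def)
  also have "\<dots> = 0"
  proof -
    have "(\<integral>\<^sup>+y. f y * indicator B y \<partial>M) \<le> (\<integral>\<^sup>+y. f y \<partial>M)"
      by (intro nn_integral_mono) (auto simp: indicator_def)
    then show ?thesis
      using le[of B] fin by (simp add: diff_eq_0_iff_ennreal)
  qed
  finally have "AE y in M. f y * indicator B y - h y * indicator B y = 0"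
    by (simp add: nn_integral_0_iff_AE)
  then show ?thesis
    using AE_space
  proof eventually_elim
    case (elim y)
    then show ?case
      by (cases "y \<in> B") (auto simp: B_def diff_eq_0_iff_ennreal)
  qed
qed

text \<open>The rationals in \<open>I\<close> and the at most two endpoints belonging to
  \<open>I\<close> suffice, as any other point has rationals of \<open>I\<close> on both sides. This
  serves to exhaust \<open>I\<close> by countably many compact intervals.\<close>

lemma interval_countable_endpoints:
  fixes I :: "real set"
  assumes "is_interval I"
  obtains C where "countable C" "C \<subseteq> I" "\<And>y. y \<in> I \<Longrightarrow> \<exists>a\<in>C. \<exists>b\<in>C. a \<le> y \<and> y \<le> b"
proof -
  define E where "E = {e\<in>I. (\<forall>y\<in>I. e \<le> y) \<or> (\<forall>y\<in>I. y \<le> e)}"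
  have "countable E"
  proof -
    have "countable {e\<in>I. \<forall>y\<in>I. e \<le> y}"
    proof (cases "\<exists>e\<in>I. \<forall>y\<in>I. e \<le> y")
      case True
      then obtain e where "e \<in> I" "\<forall>y\<in>I. e \<le> y" ..
      then have "{e\<in>I. \<forall>y\<in>I. e \<le> y} \<subseteq> {e}"
        by (auto intro: antisym)
      then show ?thesis
        by (rule countable_subset) simp
    next
      case False
      then have "{e\<in>I. \<forall>y\<in>I. e \<le> y} = {}"
        by blast
      then show ?thesis
        by (simp only: countable_empty)
    qed
    moreover have "countable {e\<in>I. \<forall>y\<in>I. y \<le> e}"
    proof (cases "\<exists>e\<in>I. \<forall>y\<in>I. y \<le> e")
      case True
      then obtain e where "e \<in> I" "\<forall>y\<in>I. y \<le> e" ..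
      then have "{e\<in>I. \<forall>y\<in>I. y \<le> e} \<subseteq> {e}"
        by (auto intro: antisym)
      then show ?thesis
        by (rule countable_subset) simp
    next
      case False
      then have "{e\<in>I. \<forall>y\<in>I. y \<le> e} = {}"
        by blast
      then show ?thesis
        by (simp only: countable_empty)
    qed
    moreover have "E = {e\<in>I. \<forall>y\<in>I. e \<le> y} \<union> {e\<in>I. \<forall>y\<in>I. y \<le> e}"
      by (auto simp: E_def)
    ultimately show ?thesis
      by simp
  qed
  then have "countable (E \<union> \<rat> \<inter> I)"
    by (auto intro: countable_rat)
  moreover have "\<exists>a\<in>E \<union> \<rat> \<inter> I. a \<le> y" if y: "y \<in> I" for y
  proof (cases "y \<in> E")
    case False
    then obtain z where z: "z \<in> I" "z < y"
      using y by (auto simp: E_def not_le)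
    then obtain q where "q \<in> \<rat>" "z < q" "q < y"
      using Rats_dense_in_real by blast
    moreover from this have "q \<in> I"
      using mem_is_interval_1_I[OF assms z(1) y, of q] by simp
    ultimately show ?thesis
      by (intro bexI[of _ q]) auto
  qed auto
  moreover have "\<exists>b\<in>E \<union> \<rat> \<inter> I. y \<le> b" if y: "y \<in> I" for y
  proof (cases "y \<in> E")
    case False
    then obtain z where z: "z \<in> I" "y < z"
      using y by (auto simp: E_def not_le)
    then obtain q where "q \<in> \<rat>" "y < q" "q < z"
      using Rats_dense_in_real by blast
    moreover from this have "q \<in> I"
      using mem_is_interval_1_I[OF assms y z(1), of q] by simp
    ultimately show ?thesis
      by (intro bexI[of _ q]) auto
  qed auto
  moreover have "E \<union> \<rat> \<inter> I \<subseteq> I"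
    by (auto simp: E_def)
  ultimately show ?thesis
    by (intro that[of "E \<union> \<rat> \<inter> I"]) blast+
qed

lemma interval_eq_countable_Union:
  fixes I :: "real set"
  assumes I: "is_interval I"
  obtains A where "countable A" "\<Union>A = I" "\<And>S. S \<in> A \<Longrightarrow> \<exists>a\<in>I. \<exists>b\<in>I. S = {a..b}"
proof -
  obtain C where C: "countable C" "C \<subseteq> I" "\<And>y. y \<in> I \<Longrightarrow> \<exists>a\<in>C. \<exists>b\<in>C. a \<le> y \<and> y \<le> b"
    using interval_countable_endpoints[OF I] by blast
  show thesis
  proof (rule that[of "(\<lambda>(a, b). {a..b}) ` (C \<times> C)"])
    show "\<Union> ((\<lambda>(a, b). {a..b}) ` (C \<times> C)) = I"
    proof
      show "\<Union> ((\<lambda>(a, b). {a..b}) ` (C \<times> C)) \<subseteq> I"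
        using C(2) by (auto intro: mem_is_interval_1_I[OF I])
      show "I \<subseteq> \<Union> ((\<lambda>(a, b). {a..b}) ` (C \<times> C))"
        using C(3) by fastforce
    qed
  qed (use C(1,2) in auto)
qed

lemma interval_borel:
  fixes I :: "real set"
  assumes "is_interval I"
  shows "I \<in> sets borel"
proof -
  obtain A where A: "countable A" "\<Union>A = I" "\<And>S. S \<in> A \<Longrightarrow> \<exists>a\<in>I. \<exists>b\<in>I. S = {a..b}"
    using interval_eq_countable_Union[OF assms] by blast
  have "\<Union>A \<in> sets borel"
    using A(1,3) by (intro sets.countable_Union) fastforce+
  then show ?thesis
    by (simp add: A(2))
qed

section \<open>The Green function as density of the occupation measure\<close>

context diffusion
begin

text \<open>Countably many compact subintervals cover \<open>I\<close>, each of finite mass, and the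
  complement of \<open>I\<close> is null.\<close>

lemma speed_measure_sigma_finite:
  assumes m: "speed_measure I P X s m"
  shows "sigma_finite_measure m"
proof -
  have sets_m: "sets m = sets borel" and null: "emeasure m (- I) = 0"
    and fin: "\<And>a b. a < b \<Longrightarrow> {a..b} \<subseteq> I \<Longrightarrow> emeasure m {a..b} < \<infinity>"
    using m unfolding speed_measure_def by blast+
  obtain A where A: "countable A" "\<Union>A = I" "\<And>S. S \<in> A \<Longrightarrow> \<exists>a\<in>I. \<exists>b\<in>I. S = {a..b}"
    using interval_eq_countable_Union[OF interval(1)] by blast
  obtain i j where ij: "i < j" "i \<in> I" "j \<in> I"
  proof -
    obtain i where i: "i \<in> interior I"
      using interval(2) by blast
    then obtain e where e: "e > 0" "cball i e \<subseteq> I"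
      using mem_interior_cball by blast
    then have "i \<in> I" "i + e \<in> I"
      by (auto simp: subset_iff dist_real_def)
    with e that show thesis
      by (metis less_add_same_cancel1)
  qed
  \<comment> \<open>Finiteness is given for \<open>a < b\<close>; enlarging the interval to contain
    the fixed points \<open>i < j\<close> also covers degenerate intervals.\<close>
  have fin': "emeasure m {a..b} < \<infinity>" if "a \<in> I" "b \<in> I" for a b
  proof -
    have "emeasure m {a..b} \<le> emeasure m {min a i..max b j}"
      using ij by (intro emeasure_mono) (auto simp: sets_m)
    also have "\<dots> < \<infinity>"
    proof (rule fin)
      have "min a i \<in> I" "max b j \<in> I"
        using ij that by (auto simp: min_def max_def)
      then show "{min a i..max b j} \<subseteq> I"
        using mem_is_interval_1_I[OF interval(1), of "min a i" "max b j"] by auto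
      show "min a i < max b j"
        using ij(1) by simp
    qed
    finally show ?thesis .
  qed
  have I: "I \<in> sets borel"
    using interval(1) by (rule interval_borel)
  show ?thesis
  proof (rule sigma_finite_measure.intro, intro exI[of _ "insert (- I) A"] conjI ballI)
    show "insert (- I) A \<subseteq> sets m"
      using I by (auto simp: sets_m dest!: A(3))
    show "\<Union> (insert (- I) A) = space m"
      using A(2) sets_eq_imp_space_eq[OF sets_m] by auto
    show "emeasure m S \<noteq> \<infinity>" if "S \<in> insert (- I) A" for S
      using that A(3) fin' null by fastforce
  qed (use A(1) in simp)
qed

text \<open>The total discounted time is at most \<open>1 / \<alpha>\<close>, the integral of
  \<open>exp (- \<alpha> t)\<close> over \<open>t \<ge> 0\<close>, evaluated here through the
  mixture formula for \<open>discount\<close> at time \<open>0\<close>.\<close>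

lemma occupation_finite:
  assumes x: "x \<in> I" and \<alpha>: "0 < \<alpha>"
  shows "occupation \<alpha> x B < \<infinity>"
proof -
  interpret prob_space "P x"
    using x by (rule prob)
  have "occupation \<alpha> x B \<le>
      (\<integral>\<^sup>+q. ennreal (1 / \<alpha>) * (ennreal (\<alpha> * exp (- \<alpha> * q)) * indicator {q. 0 \<le> q \<and> 0 \<le> ennreal q} q) \<partial>lborel)"
    unfolding occupation_def
  proof (intro nn_integral_mono)
    fix q :: real
    have "ennreal (1 / \<alpha>) * ennreal (\<alpha> * exp (- \<alpha> * q)) = ennreal (exp (- \<alpha> * q))"
      using \<alpha> by (simp add: ennreal_mult[symmetric])
    then show "ennreal (exp (- \<alpha> * q)) * indicator {0<..} q * emeasure (P x) {\<omega>\<in>\<Omega>. X q \<omega> \<in> B}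
        \<le> ennreal (1 / \<alpha>) * (ennreal (\<alpha> * exp (- \<alpha> * q)) * indicator {q. 0 \<le> q \<and> 0 \<le> ennreal q} q)"
      using mult_left_mono[OF emeasure_le_1, of "ennreal (exp (- \<alpha> * q))"]
      by (auto simp: indicator_def mult.assoc[symmetric])
  qed
  also have "\<dots> = ennreal (1 / \<alpha>) * discount \<alpha> 0"
    unfolding discount_eq_nn_integral[OF \<alpha>] by (rule nn_integral_cmult) measurable
  also have "\<dots> < \<infinity>"
    by (simp add: discount_def ennreal_mult_less_top)
  finally show ?thesis .
qed

lemma green_function_nonneg:
  assumes p: "transition_density I \<Omega> P X m p" and "x \<in> I" "y \<in> I"
  shows "0 \<le> green_function p \<alpha> x y"
  using assms unfolding green_function_def set_lebesgue_integral_def transition_density_def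
  by (intro integral_nonneg_AE) (auto simp: indicator_def)

text \<open>By Fubini, the transition density integrated against
  \<open>exp (- \<alpha> t) dt\<close> is the density of the occupation measure. The Green function,
  a Bochner integral, is \<open>0\<close> where this integral diverges; as the total occupation is
  finite, that happens only on an \<open>m\<close>-null set.\<close>

lemma occupation_eq_green_function:
  assumes m: "speed_measure I P X s m" and p: "transition_density I \<Omega> P X m p"
    and x: "x \<in> I" and \<alpha>: "0 < \<alpha>"
  shows "(\<lambda>y. ennreal (green_function p \<alpha> x y) * indicator I y) \<in> borel_measurable m"
    and "B \<in> sets borel \<Longrightarrow>
      occupation \<alpha> x B = (\<integral>\<^sup>+y\<in>B. (ennreal (green_function p \<alpha> x y) * indicator I y) \<partial>m)"
proof -
  interpret m: sigma_finite_measure m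
    using m by (rule speed_measure_sigma_finite)
  interpret LM: pair_sigma_finite lborel m
    by unfold_locales
  have sets_m [measurable_cong]: "sets m = sets borel"
    using m unfolding speed_measure_def by blast
  have I [measurable]: "I \<in> sets borel"
    using interval(1) by (rule interval_borel)
  have p_nonneg: "\<And>t y. 0 < t \<Longrightarrow> y \<in> I \<Longrightarrow> 0 \<le> p t x y"
    and p_meas: "(\<lambda>(t, y). p t x y) \<in> borel_measurable (restrict_space borel ({0<..} \<times> I))"
    and p_dens: "\<And>t B. 0 < t \<Longrightarrow> B \<in> sets borel \<Longrightarrow>
      emeasure (P x) {\<omega>\<in>\<Omega>. X t \<omega> \<in> B} = (\<integral>\<^sup>+y\<in>B \<inter> I. ennreal (p t x y) \<partial>m)"
    using p x unfolding transition_density_def by blast+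
  \<comment> \<open>The density is extended by \<open>0\<close> from
    \<open>{0<..} \<times> I\<close>, where it is known to be measurable and nonnegative.\<close>
  define q where "q = (\<lambda>t y. indicator ({0<..} \<times> I) (t, y) *\<^sub>R p t x y)"
  have "{0::real<..} \<times> I \<in> sets (borel \<Otimes>\<^sub>M borel)"
    by measurable
  then have prod: "{0<..} \<times> I \<in> sets (borel :: (real \<times> real) measure)"
    by (simp only: borel_prod)
  then have "(\<lambda>ty. indicator ({0<..} \<times> I) ty *\<^sub>R (case ty of (t, y) \<Rightarrow> p t x y)) \<in> borel_measurable borel"
    using p_meas by (subst (asm) borel_measurable_restrict_space_iff) (auto simp: prod)
  then have q_meas: "(\<lambda>(t, y). q t y) \<in> borel_measurable (borel \<Otimes>\<^sub>M borel)"
    unfolding borel_prod q_def by (simp add: case_prod_unfold)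
  have [measurable]: "(\<lambda>z. q (f z) (h z)) \<in> borel_measurable N"
    if "f \<in> borel_measurable N" "h \<in> borel_measurable N" for f h and N :: "'z measure"
    using measurable_compose[OF measurable_Pair[OF that] q_meas] by simp
  define K where "K = (\<lambda>y. \<integral>\<^sup>+t. ennreal (exp (- \<alpha> * t) * q t y) \<partial>lborel)"
  have K_meas [measurable]: "K \<in> borel_measurable m"
    unfolding K_def by measurable
  have green: "green_function p \<alpha> x y = enn2real (K y)" if y: "y \<in> I" for y
  proof -
    have "green_function p \<alpha> x y = (\<integral>t. exp (- \<alpha> * t) * q t y \<partial>lborel)"
      unfolding green_function_def set_lebesgue_integral_def q_def
      using y by (intro Bochner_Integration.integral_cong) (auto simp: indicator_def)
    also have "\<dots> = enn2real (K y)"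
      unfolding K_def
    proof (rule integral_eq_nn_integral)
      show "(\<lambda>t. exp (- \<alpha> * t) * q t y) \<in> borel_measurable lborel"
        by measurable
    qed (auto simp: q_def p_nonneg indicator_def y)
    finally show ?thesis .
  qed
  have K_int: "occupation \<alpha> x B = (\<integral>\<^sup>+y. K y * indicator B y \<partial>m)"
    if B [measurable]: "B \<in> sets borel" for B
  proof -
    have "occupation \<alpha> x B =
        (\<integral>\<^sup>+t. (\<integral>\<^sup>+y. ennreal (exp (- \<alpha> * t) * q t y) * indicator B y \<partial>m) \<partial>lborel)"
      unfolding occupation_def
    proof (intro nn_integral_cong)
      fix t :: real
      show "ennreal (exp (- \<alpha> * t)) * indicator {0<..} t * emeasure (P x) {\<omega>\<in>\<Omega>. X t \<omega> \<in> B} =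
          (\<integral>\<^sup>+y. ennreal (exp (- \<alpha> * t) * q t y) * indicator B y \<partial>m)"
      proof (cases "0 < t")
        case True
        have "(\<integral>\<^sup>+y. ennreal (exp (- \<alpha> * t) * q t y) * indicator B y \<partial>m) =
            (\<integral>\<^sup>+y. ennreal (exp (- \<alpha> * t)) * (ennreal (q t y) * indicator B y) \<partial>m)"
          by (intro nn_integral_cong) (simp add: ennreal_mult' mult.assoc)
        also have "\<dots> = ennreal (exp (- \<alpha> * t)) * (\<integral>\<^sup>+y. ennreal (q t y) * indicator B y \<partial>m)"
          by (rule nn_integral_cmult) measurable
        also have "(\<integral>\<^sup>+y. ennreal (q t y) * indicator B y \<partial>m) = (\<integral>\<^sup>+y\<in>B \<inter> I. ennreal (p t x y) \<partial>m)"
          using True by (intro nn_integral_cong) (auto simp: q_def indicator_def)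
        finally show ?thesis
          using True p_dens[OF True B] by simp
      qed (simp add: q_def)
    qed
    also have "\<dots> = (\<integral>\<^sup>+y. (\<integral>\<^sup>+t. ennreal (exp (- \<alpha> * t) * q t y) * indicator B y \<partial>lborel) \<partial>m)"
      by (rule LM.Fubini'[symmetric]) measurable
    also have "\<dots> = (\<integral>\<^sup>+y. K y * indicator B y \<partial>m)"
      unfolding K_def by (intro nn_integral_cong nn_integral_multc) measurable
    finally show ?thesis .
  qed
  have "(\<integral>\<^sup>+y. K y \<partial>m) \<noteq> \<infinity>"
    using occupation_finite[OF x \<alpha>, of UNIV] K_int[of UNIV] by simp
  then have fin: "AE y in m. K y \<noteq> \<infinity>"
    by (intro nn_integral_PInf_AE) auto
  have green_I: "ennreal (green_function p \<alpha> x y) * indicator I y = ennreal (enn2real (K y)) * indicator I y" for y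
    by (simp add: green indicator_def)
  show "(\<lambda>y. ennreal (green_function p \<alpha> x y) * indicator I y) \<in> borel_measurable m"
    unfolding green_I by measurable
  show "occupation \<alpha> x B = (\<integral>\<^sup>+y\<in>B. (ennreal (green_function p \<alpha> x y) * indicator I y) \<partial>m)"
    if "B \<in> sets borel"
    unfolding K_int[OF that] green_I
  proof (rule nn_integral_cong_AE)
    show "AE y in m. K y * indicator B y = ennreal (enn2real (K y)) * indicator I y * indicator B y"
      using fin
    proof eventually_elim
      case (elim y)
      have "K y = 0" if "y \<notin> I"
        using that by (simp add: K_def q_def)
      with elim show ?case
        by (auto simp: indicator_def less_top)
    qed
  qed
qed

text \<open>Green functions are densities of the occupation measures, so an inequality between these
  measures on the Borel subsets of \<open>C\<close> passes to the densities almost everywhere on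
  \<open>I \<inter> C\<close>.\<close>

lemma green_function_AE_le:
  assumes m: "speed_measure I P X s m" and p: "transition_density I \<Omega> P X m p"
    and x: "x \<in> I" and z: "z \<in> I" and \<alpha>: "0 < \<alpha>" and cd: "0 \<le> c" "0 \<le> d"
    and C [measurable]: "C \<in> sets borel"
    and le: "\<And>B. B \<in> sets borel \<Longrightarrow> B \<subseteq> C \<Longrightarrow>
      ennreal c * occupation \<alpha> x B \<le> ennreal d * occupation \<alpha> z B"
  shows "AE y in m. y \<in> I \<inter> C \<longrightarrow> c * green_function p \<alpha> x y \<le> d * green_function p \<alpha> z y"
proof -
  have sets_m [measurable_cong]: "sets m = sets borel"
    using m unfolding speed_measure_def by blast
  define G where "G = (\<lambda>x y. ennreal (green_function p \<alpha> x y) * indicator I y)"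
  have [measurable]: "G x \<in> borel_measurable m" "G z \<in> borel_measurable m"
    unfolding G_def
    using occupation_eq_green_function(1)[OF m p _ \<alpha>] x z by auto
  have occ: "ennreal c * occupation \<alpha> w B = (\<integral>\<^sup>+y\<in>B. ennreal c * G w y \<partial>m)"
    if "w \<in> {x, z}" "B \<in> sets borel" for w B c
  proof -
    have [measurable]: "G w \<in> borel_measurable m" "B \<in> sets borel"
      using that by auto
    have "w \<in> I"
      using that x z by auto
    then have "ennreal c * occupation \<alpha> w B = ennreal c * (\<integral>\<^sup>+y\<in>B. G w y \<partial>m)"
      unfolding G_def using that(2) by (subst occupation_eq_green_function(2)[OF m p _ \<alpha>]) auto
    also have "\<dots> = (\<integral>\<^sup>+y. ennreal c * (G w y * indicator B y) \<partial>m)"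
      by (rule nn_integral_cmult[symmetric]) measurable
    finally show ?thesis
      by (simp add: mult.assoc)
  qed
  have "AE y in m. ennreal c * G x y * indicator C y \<le> ennreal d * G z y * indicator C y"
  proof (rule AE_le_of_set_nn_integral_le)
    show "(\<integral>\<^sup>+y. ennreal c * G x y * indicator C y \<partial>m) < \<infinity>"
      using occ[of x C c, symmetric] occupation_finite[OF x \<alpha>, of C]
      by (simp add: ennreal_mult_less_top)
    fix B assume "B \<in> sets m"
    then have B: "B \<inter> C \<in> sets borel"
      by (simp add: sets_m)
    have *: "(\<integral>\<^sup>+y\<in>B. ennreal c * G w y * indicator C y \<partial>m) = (\<integral>\<^sup>+y\<in>B \<inter> C. ennreal c * G w y \<partial>m)" for c w
      by (intro nn_integral_cong) (auto simp: indicator_def)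
    show "(\<integral>\<^sup>+y\<in>B. ennreal c * G x y * indicator C y \<partial>m) \<le> (\<integral>\<^sup>+y\<in>B. ennreal d * G z y * indicator C y \<partial>m)"
      unfolding * using le[OF B] occ[OF _ B, of x c] occ[OF _ B, of z d] by simp
  qed measurable
  then show ?thesis
  proof eventually_elim
    case (elim y)
    show ?case
    proof
      assume y: "y \<in> I \<inter> C"
      then have "0 \<le> green_function p \<alpha> x y" "0 \<le> green_function p \<alpha> z y"
        using green_function_nonneg[OF p] x z by auto
      with elim y cd show "c * green_function p \<alpha> x y \<le> d * green_function p \<alpha> z y"
        by (simp add: G_def ennreal_mult[symmetric])
    qed
  qed
qed

lemma green_function_hitting_le:
  assumes m: "speed_measure I P X s m" and p: "transition_density I \<Omega> P X m p"
    and x: "x \<in> I" and z: "z \<in> I" and \<alpha>: "0 < \<alpha>" and "0 \<le> \<rho>"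
    and L: "(\<integral>\<^sup>+\<omega>. discount \<alpha> (hitting_time X {z} \<omega>) \<partial>P x) = ennreal \<rho>"
  shows "AE y in m. y \<in> I \<longrightarrow> \<rho> * green_function p \<alpha> z y \<le> green_function p \<alpha> x y"
  using green_function_AE_le[OF m p z x \<alpha> \<open>0 \<le> \<rho>\<close> zero_le_one, of UNIV]
    occupation_ge[OF x \<alpha> z, unfolded L] by simp

lemma green_function_hitting_eq:
  assumes m: "speed_measure I P X s m" and p: "transition_density I \<Omega> P X m p"
    and x: "x \<in> I" and z: "z \<in> I" and \<alpha>: "0 < \<alpha>" and "0 \<le> \<rho>" and "x \<le> z"
    and L: "(\<integral>\<^sup>+\<omega>. discount \<alpha> (hitting_time X {z} \<omega>) \<partial>P x) = ennreal \<rho>"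
  shows "AE y in m. y \<in> I \<and> z < y \<longrightarrow> green_function p \<alpha> x y = \<rho> * green_function p \<alpha> z y"
proof -
  have "AE y in m. y \<in> I \<inter> {z<..} \<longrightarrow> 1 * green_function p \<alpha> x y \<le> \<rho> * green_function p \<alpha> z y"
    by (rule green_function_AE_le[OF m p x z \<alpha> zero_le_one \<open>0 \<le> \<rho>\<close>])
      (simp_all add: occupation_eq[OF x \<alpha> z _ \<open>x \<le> z\<close>] L)
  then show ?thesis
    using green_function_hitting_le[OF m p x z \<alpha> \<open>0 \<le> \<rho>\<close> L] by eventually_elim auto
qed

text \<open>Started at \<open>x \<ge> xs\<close>, the process is almost surely in
  \<open>{xs..}\<close> at time \<open>0\<close>; the optimal stopping time vanishes and
  \<open>g x\<close> is collected at once.\<close>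

lemma right_sided_value_function:
  assumes rs: "right_sided I \<Omega> P X \<alpha> g xs" and x: "x \<in> I" "xs \<le> x"
  shows "value_function I \<Omega> P X \<alpha> g x = ennreal (g x)"
proof -
  interpret prob_space "P x"
    using x(1) by (rule prob)
  interpret C: prob_space "completion (P x)"
    by (rule prob_space_completion)
  have hit: "hitting_time X {xs..} \<omega> = 0" if "X 0 \<omega> = x" for \<omega>
  proof -
    have "hitting_time X {xs..} \<omega> \<le> ennreal 0"
      unfolding hitting_time_def using that x(2)
      by (intro Inf_lower) (auto simp del: ennreal_0)
    then show ?thesis
      by simp
  qed
  have "value_function I \<Omega> P X \<alpha> g x = expected_reward P X \<alpha> g (hitting_time X {xs..}) x"
    using rs x(1) by (simp add: right_sided_def optimal_stopping_time_def)
  also have "\<dots> = (\<integral>\<^sup>+\<omega>. ennreal (g x) \<partial>completion (P x))"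
    unfolding expected_reward_def
  proof (rule nn_integral_cong_AE)
    show "AE \<omega> in completion (P x). discount \<alpha> (hitting_time X {xs..} \<omega>) *
        ennreal (g (X (enn2real (hitting_time X {xs..} \<omega>)) \<omega>)) = ennreal (g x)"
      using AE_completion[OF start[OF x(1)]]
      by eventually_elim (simp add: hit discount_def)
  qed
  also have "\<dots> = ennreal (g x)"
    by (simp add: C.emeasure_space_1 del: space_completion)
  finally show ?thesis .
qed

section \<open>Green functions and potentials on either side of a level\<close>

lemma green_function_left:
  assumes m: "speed_measure I P X s m" and p: "transition_density I \<Omega> P X m p" and \<alpha>: "0 < \<alpha>"
    and fs: "fundamental_solutions I P X s m \<alpha> \<phi> \<psi>"
    and x: "x \<in> I" and z: "z \<in> I" and "x \<le> z"
  shows "AE y in m. y \<in> I \<and> z < y \<longrightarrow>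
    green_function p \<alpha> x y = \<psi> x / \<psi> z * green_function p \<alpha> z y"
proof (rule green_function_hitting_eq[OF m p x z \<alpha>])
  show "(\<integral>\<^sup>+\<omega>. discount \<alpha> (hitting_time X {z} \<omega>) \<partial>P x) = ennreal (\<psi> x / \<psi> z)"
    using fs x z \<open>x \<le> z\<close> unfolding fundamental_solutions_def by blast
  show "0 \<le> \<psi> x / \<psi> z"
    using fs x z unfolding fundamental_solutions_def by (simp add: less_imp_le)
qed fact

text \<open>Hitting \<open>z\<close> from \<open>x\<close> gives the lower bound
  \<open>\<phi> x / \<phi> z * G z y\<close> for \<open>G x y\<close>, and hitting \<open>x\<close>
  from \<open>z\<close> the upper bound \<open>\<psi> x / \<psi> z * G z y\<close>. For
  \<open>z < y \<le> x\<close> the gap between them bounds the error; for \<open>y > x\<close> the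
  process has to pass \<open>x\<close> on its way from \<open>z\<close>, and the upper bound is an
  equality.\<close>

lemma green_function_right:
  assumes m: "speed_measure I P X s m" and p: "transition_density I \<Omega> P X m p" and \<alpha>: "0 < \<alpha>"
    and fs: "fundamental_solutions I P X s m \<alpha> \<phi> \<psi>"
    and x: "x \<in> I" and z: "z \<in> I" and "z \<le> x"
  shows "AE y in m. y \<in> I \<and> z < y \<longrightarrow>
    \<bar>\<psi> x / \<psi> z * green_function p \<alpha> z y - green_function p \<alpha> x y\<bar> \<le>
      (\<psi> x / \<psi> z - \<phi> x / \<phi> z) * (indicator {z<..x} y * green_function p \<alpha> z y)"
proof -
  have pos: "0 < \<phi> x" "0 < \<phi> z" "0 < \<psi> x" "0 < \<psi> z"
    and L: "(\<integral>\<^sup>+\<omega>. discount \<alpha> (hitting_time X {z} \<omega>) \<partial>P x) = ennreal (\<phi> x / \<phi> z)"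
      "(\<integral>\<^sup>+\<omega>. discount \<alpha> (hitting_time X {x} \<omega>) \<partial>P z) = ennreal (\<psi> z / \<psi> x)"
    using fs x z \<open>z \<le> x\<close> unfolding fundamental_solutions_def by blast+
  have "AE y in m. y \<in> I \<longrightarrow> \<phi> x / \<phi> z * green_function p \<alpha> z y \<le> green_function p \<alpha> x y"
    using pos by (intro green_function_hitting_le[OF m p x z \<alpha> _ L(1)]) simp
  moreover have "AE y in m. y \<in> I \<longrightarrow> \<psi> z / \<psi> x * green_function p \<alpha> x y \<le> green_function p \<alpha> z y"
    using pos by (intro green_function_hitting_le[OF m p z x \<alpha> _ L(2)]) simp
  moreover have "AE y in m. y \<in> I \<and> x < y \<longrightarrow>
      green_function p \<alpha> z y = \<psi> z / \<psi> x * green_function p \<alpha> x y"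
    by (rule green_function_left[OF m p \<alpha> fs z x \<open>z \<le> x\<close>])
  ultimately show ?thesis
  proof eventually_elim
    case (elim y)
    show ?case
    proof (intro impI, elim conjE)
      assume y: "y \<in> I" "z < y"
      show "\<bar>\<psi> x / \<psi> z * green_function p \<alpha> z y - green_function p \<alpha> x y\<bar> \<le>
          (\<psi> x / \<psi> z - \<phi> x / \<phi> z) * (indicator {z<..x} y * green_function p \<alpha> z y)"
      proof (cases "y \<le> x")
        case True
        have "green_function p \<alpha> x y \<le> \<psi> x / \<psi> z * green_function p \<alpha> z y"
          using elim(2) y pos by (simp add: field_simps)
        moreover have "\<phi> x / \<phi> z * green_function p \<alpha> z y \<le> green_function p \<alpha> x y"
          using elim(1) y by simp
        ultimately show ?thesis
          using True y by (simp add: left_diff_distrib)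
      next
        case False
        then show ?thesis
          using elim(3) y pos by simp
      qed
    qed
  qed
qed

lemma green_potential_left:
  assumes m: "speed_measure I P X s m" and p: "transition_density I \<Omega> P X m p" and \<alpha>: "0 < \<alpha>"
    and fs: "fundamental_solutions I P X s m \<alpha> \<phi> \<psi>"
    and x: "x \<in> I" and z: "z \<in> I" and "x \<le> z"
    and int: "\<And>x. x \<in> I \<Longrightarrow> set_integrable m {y\<in>I. z < y} (\<lambda>y. green_function p \<alpha> x y * f y)"
  shows "(LINT y:{y\<in>I. z < y}|m. green_function p \<alpha> x y * f y) =
    \<psi> x / \<psi> z * (LINT y:{y\<in>I. z < y}|m. green_function p \<alpha> z y * f y)"
proof -
  have "(LINT y:{y\<in>I. z < y}|m. green_function p \<alpha> x y * f y) =
      (LINT y:{y\<in>I. z < y}|m. \<psi> x / \<psi> z * (green_function p \<alpha> z y * f y))"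
    unfolding set_lebesgue_integral_def
  proof (rule integral_cong_AE)
    show "AE y in m. indicator {y\<in>I. z < y} y *\<^sub>R (green_function p \<alpha> x y * f y) =
        indicator {y\<in>I. z < y} y *\<^sub>R (\<psi> x / \<psi> z * (green_function p \<alpha> z y * f y))"
      using green_function_left[OF m p \<alpha> fs x z \<open>x \<le> z\<close>]
      by eventually_elim (auto simp: indicator_def)
    have "set_integrable m {y\<in>I. z < y} (\<lambda>y. \<psi> x / \<psi> z * (green_function p \<alpha> z y * f y))"
      using int[OF z] by (intro set_integrable_mult_right)
    then show "(\<lambda>y. indicator {y\<in>I. z < y} y *\<^sub>R (\<psi> x / \<psi> z * (green_function p \<alpha> z y * f y)))
        \<in> borel_measurable m"
      unfolding set_integrable_def by (rule borel_measurable_integrable)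
    show "(\<lambda>y. indicator {y\<in>I. z < y} y *\<^sub>R (green_function p \<alpha> x y * f y)) \<in> borel_measurable m"
      using int[OF x] unfolding set_integrable_def by (rule borel_measurable_integrable)
  qed
  then show ?thesis
    by (simp only: set_integral_mult_right)
qed

text \<open>Integrating the pointwise bound against \<open>f\<close> leaves the first factor outside
  and confines the error to \<open>(z, x]\<close>. As \<open>x\<close> decreases to \<open>z\<close>
  both factors on the right become small, which makes the error of higher order.\<close>

lemma green_potential_right:
  assumes m: "speed_measure I P X s m" and p: "transition_density I \<Omega> P X m p" and \<alpha>: "0 < \<alpha>"
    and fs: "fundamental_solutions I P X s m \<alpha> \<phi> \<psi>"
    and x: "x \<in> I" and z: "z \<in> I" and "z \<le> x"
    and int: "\<And>x. x \<in> I \<Longrightarrow> set_integrable m {y\<in>I. z < y} (\<lambda>y. green_function p \<alpha> x y * f y)"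
  shows "\<bar>\<psi> x / \<psi> z * (LINT y:{y\<in>I. z < y}|m. green_function p \<alpha> z y * f y) -
      (LINT y:{y\<in>I. z < y}|m. green_function p \<alpha> x y * f y)\<bar> \<le>
    (\<psi> x / \<psi> z - \<phi> x / \<phi> z) *
      (LINT y:{z<..x}|m. \<bar>indicator {y\<in>I. z < y} y * (green_function p \<alpha> z y * f y)\<bar>)"
proof -
  have sets_m: "sets m = sets borel"
    using m unfolding speed_measure_def by blast
  define c where "c = \<psi> x / \<psi> z"
  define \<delta> where "\<delta> = \<psi> x / \<psi> z - \<phi> x / \<phi> z"
  define h where "h = (\<lambda>x y. indicator {y\<in>I. z < y} y * (green_function p \<alpha> x y * f y))"
  have h: "integrable m (h w)" if "w \<in> I" for w
    using int[OF that] by (simp add: set_integrable_def h_def)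
  have h_abs: "integrable m (\<lambda>y. indicator {z<..x} y *\<^sub>R \<bar>h z y\<bar>)"
    using h[OF z] by (intro integrable_mult_indicator integrable_abs) (auto simp: sets_m)
  have "\<bar>c * (\<integral>y. h z y \<partial>m) - (\<integral>y. h x y \<partial>m)\<bar> = \<bar>\<integral>y. c * h z y - h x y \<partial>m\<bar>"
    using h[OF x] h[OF z] by simp
  also have "\<dots> \<le> (\<integral>y. \<bar>c * h z y - h x y\<bar> \<partial>m)"
    by (rule integral_abs_bound)
  also have "\<dots> \<le> (\<integral>y. \<delta> * (indicator {z<..x} y *\<^sub>R \<bar>h z y\<bar>) \<partial>m)"
  proof (rule integral_mono_AE)
    show "AE y in m. \<bar>c * h z y - h x y\<bar> \<le> \<delta> * (indicator {z<..x} y *\<^sub>R \<bar>h z y\<bar>)"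
      using green_function_right[OF m p \<alpha> fs x z \<open>z \<le> x\<close>]
    proof eventually_elim
      case (elim y)
      show ?case
      proof (cases "y \<in> I \<and> z < y")
        case True
        have "\<bar>c * h z y - h x y\<bar> = \<bar>c * green_function p \<alpha> z y - green_function p \<alpha> x y\<bar> * \<bar>f y\<bar>"
          using True by (simp add: h_def abs_mult[symmetric] algebra_simps)
        also have "\<dots> \<le> \<delta> * (indicator {z<..x} y * green_function p \<alpha> z y) * \<bar>f y\<bar>"
          using elim True by (intro mult_right_mono) (auto simp: c_def \<delta>_def)
        also have "\<dots> = \<delta> * (indicator {z<..x} y *\<^sub>R \<bar>h z y\<bar>)"
          using True green_function_nonneg[OF p z, of y \<alpha>] by (simp add: h_def abs_mult)
        finally show ?thesis .
      qed (auto simp: h_def)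
    qed
  qed (use h[OF x] h[OF z] h_abs in auto)
  also have "\<dots> = \<delta> * (\<integral>y. indicator {z<..x} y *\<^sub>R \<bar>h z y\<bar> \<partial>m)"
    by simp
  finally show ?thesis
    by (simp add: set_lebesgue_integral_def h_def c_def \<delta>_def)
qed

end

section \<open>Smooth fit\<close>

theorem mainTheorem6:
  fixes I :: "real set" and \<Omega> :: "'w set"
    and P :: "real \<Rightarrow> 'w measure" and X :: "real \<Rightarrow> 'w \<Rightarrow> real"
    and s :: "real \<Rightarrow> real" and m :: "real measure"
    and p :: "real \<Rightarrow> real \<Rightarrow> real \<Rightarrow> real"
    and \<phi> \<psi> g :: "real \<Rightarrow> real" and \<alpha> xs :: real
  defines "V \<equiv> value_function I \<Omega> P X \<alpha> g"
    and "G \<equiv> green_function p \<alpha>"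
    and "Lg \<equiv> feller_op I s m g"
  assumes "diffusion I \<Omega> P X"
    and "scale_function I \<Omega> P X s"
    and "speed_measure I P X s m"
    and "transition_density I \<Omega> P X m p"
    and "\<alpha> > 0"
    and "fundamental_solutions I P X s m \<alpha> \<phi> \<psi>"
    and "\<forall>x\<in>I. 0 \<le> g x"
    and "lower_semicontinuous_on I g"
    and "xs \<in> interior I"
    and "right_sided I \<Omega> P X \<alpha> g xs"
    and "AE y in m. y \<in> I \<and> xs < y \<longrightarrow> (\<exists>D. has_feller I s m g D y)"
    and "\<forall>x\<in>I. set_integrable m {y\<in>I. xs < y} (\<lambda>y. G x y * (\<alpha> * g y - Lg y))"
    and "\<forall>x\<in>I. enn2ereal (V x) = ereal (LINT y:{y\<in>I. xs < y}|m. G x y * (\<alpha> * g y - Lg y))"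
    and "g field_differentiable (at xs)"
    and "(\<psi> field_differentiable (at xs) \<and> deriv \<psi> xs \<noteq> 0) \<or>
         (measure m {xs} = 0 \<and> s field_differentiable (at xs) \<and> deriv s xs \<noteq> 0)"
  shows "(\<lambda>x. enn2real (V x)) field_differentiable (at xs) \<and>
         deriv (\<lambda>x. enn2real (V x)) xs = deriv g xs"
proof -
  interpret diffusion I \<Omega> P X
    by fact
  note m = \<open>speed_measure I P X s m\<close>
  note p = \<open>transition_density I \<Omega> P X m p\<close>
  note fs = \<open>fundamental_solutions I P X s m \<alpha> \<phi> \<psi>\<close>
  note xs = \<open>xs \<in> interior I\<close>
  have xs_I: "xs \<in> I"
    using xs interior_subset by blast
  have sets_m: "sets m = sets borel"
    and m_pos: "\<And>a b. a < b \<Longrightarrow> {a..b} \<subseteq> I \<Longrightarrow> 0 < emeasure m {a<..<b}"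
    and m_fin: "\<And>a b. a < b \<Longrightarrow> {a..b} \<subseteq> I \<Longrightarrow> emeasure m {a..b} < \<infinity>"
    using m unfolding speed_measure_def by blast+
  have s_mono: "strict_mono_on I s" and s_cont: "continuous_on I s"
    using \<open>scale_function I \<Omega> P X s\<close> by (auto simp: scale_function_def)
  have \<psi>_pos: "0 < \<psi> xs" and \<psi>_mono: "mono_on I \<psi>"
    and \<psi>_harm: "alpha_harmonic I s m \<alpha> \<psi>" and \<phi>_harm: "alpha_harmonic I s m \<alpha> \<phi>"
    and \<phi>_pos: "0 < \<phi> xs"
    using fs xs_I unfolding fundamental_solutions_def by blast+
  note near_right = eventually_at_side_interior(1)[OF xs]
  note near_left = eventually_at_side_interior(2)[OF xs]
  have s_ne_right: "\<forall>\<^sub>F y in at_right xs. s y \<noteq> s xs"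
    using near_right by eventually_elim (use s_mono xs_I in \<open>force dest: strict_mono_onD\<close>)
  have s_ne_left: "\<forall>\<^sub>F y in at_left xs. s y \<noteq> s xs"
    using near_left by eventually_elim (use s_mono xs_I in \<open>force dest: strict_mono_onD\<close>)

  \<comment> \<open>Scale derivatives of the fundamental solutions at the threshold\<close>
  define d\<psi> where "d\<psi> = right_scale_derivative s \<psi> xs"
  define d\<phi> where "d\<phi> = right_scale_derivative s \<phi> xs"
  have d\<psi>_right: "((\<lambda>y. (\<psi> y - \<psi> xs) / (s y - s xs)) \<longlongrightarrow> d\<psi>) (at_right xs)"
    and d\<phi>_right: "((\<lambda>y. (\<phi> y - \<phi> xs) / (s y - s xs)) \<longlongrightarrow> d\<phi>) (at_right xs)"
    using alpha_harmonic_right_derivative[OF _ xs] \<psi>_harm \<phi>_harm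
    by (auto simp: has_right_scale_derivative_def d\<psi>_def d\<phi>_def)
  have d\<psi>_pos: "0 < d\<psi>"
    unfolding d\<psi>_def using \<psi>_harm xs s_mono \<psi>_mono \<open>\<alpha> > 0\<close> \<psi>_pos
    by (rule alpha_harmonic_right_derivative_pos)

  \<comment> \<open>Either alternative leads to the two facts used from here on: an ordinary
    derivative of \<open>\<psi>\<close>, and a right derivative of \<open>s\<close> that converts
    right scale derivatives into ordinary right derivatives.\<close>
  obtain d \<sigma> where \<psi>_deriv: "(\<psi> has_field_derivative d) (at xs)"
    and s_right: "((\<lambda>y. (s y - s xs) / (y - xs)) \<longlongrightarrow> \<sigma>) (at_right xs)"
    using \<open>(\<psi> field_differentiable (at xs) \<and> deriv \<psi> xs \<noteq> 0) \<or>
         (measure m {xs} = 0 \<and> s field_differentiable (at xs) \<and> deriv s xs \<noteq> 0)\<close>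
  proof (elim disjE conjE)
    assume "\<psi> field_differentiable (at xs)"
    then obtain d where d: "(\<psi> has_field_derivative d) (at xs)"
      by (auto simp: field_differentiable_def)
    \<comment> \<open>The right quotient of \<open>s\<close> is recovered by dividing the ordinary
      quotient of \<open>\<psi>\<close> by its scale quotient, whose limit \<open>d\<psi>\<close> is
      positive.\<close>
    have "((\<lambda>y. (\<psi> y - \<psi> xs) / (y - xs) / ((\<psi> y - \<psi> xs) / (s y - s xs))) \<longlongrightarrow> d / d\<psi>) (at_right xs)"
      using has_field_derivative_sides(2)[OF d] d\<psi>_right d\<psi>_pos by (intro tendsto_divide) auto
    moreover have "\<forall>\<^sub>F y in at_right xs.
        (\<psi> y - \<psi> xs) / (y - xs) / ((\<psi> y - \<psi> xs) / (s y - s xs)) = (s y - s xs) / (y - xs)"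
      using order_tendstoD(1)[OF d\<psi>_right d\<psi>_pos]
    proof eventually_elim
      case (elim y)
      then have "\<psi> y - \<psi> xs \<noteq> 0"
        by auto
      then show ?case
        by simp
    qed
    ultimately have "((\<lambda>y. (s y - s xs) / (y - xs)) \<longlongrightarrow> d / d\<psi>) (at_right xs)"
      by (rule Lim_transform_eventually)
    with d show thesis
      by (rule that)
  next
    assume atom: "measure m {xs} = 0" and "s field_differentiable (at xs)"
    then obtain \<sigma> where \<sigma>: "(s has_field_derivative \<sigma>) (at xs)"
      by (auto simp: field_differentiable_def)
    note \<sigma>_sides = has_field_derivative_sides[OF \<sigma>]
    \<comment> \<open>As \<open>m\<close> has no atom at \<open>xs\<close>, the left scale
      derivative of \<open>\<psi>\<close> agrees with the right one, and the chain rule gives the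
      same ordinary derivative from both sides.\<close>
    have "((\<lambda>y. (\<psi> y - \<psi> xs) / (s y - s xs)) \<longlongrightarrow> d\<psi>) (at_left xs)"
      unfolding d\<psi>_def
      using \<psi>_harm xs s_mono s_cont sets_m m_pos m_fin atom by (rule alpha_harmonic_left_derivative)
    then have "(\<psi> has_field_derivative d\<psi> * \<sigma>) (at xs)"
      using d\<psi>_right \<sigma>_sides s_ne_left s_ne_right
      by (intro has_field_derivative_from_sides difference_quotient_chain)
    then show thesis
      using \<sigma>_sides(2) by (rule that)
  qed

  \<comment> \<open>The value function as a Green potential and its derivative\<close>
  define f where "f = (\<lambda>y. \<alpha> * g y - Lg y)"
  define v where "v = (\<lambda>x. enn2real (V x))"
  have int: "set_integrable m {y\<in>I. xs < y} (\<lambda>y. green_function p \<alpha> x y * f y)" if "x \<in> I" for x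
    using \<open>\<forall>x\<in>I. set_integrable m {y\<in>I. xs < y} (\<lambda>y. G x y * (\<alpha> * g y - Lg y))\<close> that
    by (simp add: f_def G_def)
  have v_eq: "v x = (LINT y:{y\<in>I. xs < y}|m. green_function p \<alpha> x y * f y)" if "x \<in> I" for x
  proof -
    have "enn2ereal (V x) = ereal (LINT y:{y\<in>I. xs < y}|m. G x y * (\<alpha> * g y - Lg y))"
      using that assms by blast
    then show ?thesis
      unfolding v_def enn2real_def f_def G_def by (simp only: o_apply real_of_ereal.simps)
  qed
  have v_g: "v x = g x" if "x \<in> I" "xs \<le> x" for x
    using right_sided_value_function[OF \<open>right_sided I \<Omega> P X \<alpha> g xs\<close> that]
      \<open>\<forall>x\<in>I. 0 \<le> g x\<close> that by (simp add: v_def V_def)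

  define c where "c = v xs / \<psi> xs"
  define \<delta> where "\<delta> = (\<lambda>x. \<psi> x / \<psi> xs - \<phi> x / \<phi> xs)"
  define \<epsilon> where "\<epsilon> = (\<lambda>x. LINT y:{xs<..x}|m.
    \<bar>indicator {y\<in>I. xs < y} y * (green_function p \<alpha> xs y * f y)\<bar>)"
  have v_deriv: "(v has_field_derivative c * d) (at xs)"
    using \<psi>_deriv
  proof (rule derivative_paste)
    show "v xs = c * \<psi> xs"
      using \<psi>_pos by (simp add: c_def)
    show "\<forall>\<^sub>F x in at_left xs. v x = c * \<psi> x"
      using near_left
    proof eventually_elim
      case (elim x)
      then have x: "x \<in> I" "x \<le> xs"
        by auto
      have "v x = \<psi> x / \<psi> xs * v xs"
        unfolding v_eq[OF x(1)] v_eq[OF xs_I]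
        by (rule green_potential_left[OF m p \<open>\<alpha> > 0\<close> fs x(1) xs_I x(2) int])
      then show ?case
        by (simp add: c_def)
    qed
    show "\<forall>\<^sub>F x in at_right xs. \<bar>c * \<psi> x - v x\<bar> \<le> \<delta> x * \<epsilon> x"
      using near_right
    proof eventually_elim
      case (elim x)
      then have x: "x \<in> I" "xs \<le> x"
        by auto
      have "\<bar>\<psi> x / \<psi> xs * v xs - v x\<bar> \<le> \<delta> x * \<epsilon> x"
        unfolding v_eq[OF x(1)] v_eq[OF xs_I] \<delta>_def \<epsilon>_def
        by (rule green_potential_right[OF m p \<open>\<alpha> > 0\<close> fs x(1) xs_I x(2) int])
      then show ?case
        by (simp add: c_def mult.commute)
    qed
    show "(\<epsilon> \<longlongrightarrow> 0) (at_right xs)"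
      unfolding \<epsilon>_def using int[OF xs_I] sets_m
      by (intro set_integral_at_right_tendsto_zero integrable_abs) (simp_all add: set_integrable_def)
    \<comment> \<open>Because \<open>\<delta> xs = 0\<close>, the ratio
      \<open>\<delta> y / (y - xs)\<close> is a difference quotient. It splits into those of
      \<open>\<psi>\<close> and \<open>\<phi>\<close>, whose right limits come from the scale
      derivatives by the chain rule.\<close>
    have "((\<lambda>y. (\<psi> y - \<psi> xs) / (y - xs) / \<psi> xs - (\<phi> y - \<phi> xs) / (y - xs) / \<phi> xs)
        \<longlongrightarrow> d\<psi> * \<sigma> / \<psi> xs - d\<phi> * \<sigma> / \<phi> xs) (at_right xs)"
      using difference_quotient_chain[OF d\<psi>_right s_right s_ne_right]
        difference_quotient_chain[OF d\<phi>_right s_right s_ne_right] \<psi>_pos \<phi>_pos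
      by (intro tendsto_diff tendsto_divide tendsto_const) auto
    moreover have "(\<psi> y - \<psi> xs) / (y - xs) / \<psi> xs - (\<phi> y - \<phi> xs) / (y - xs) / \<phi> xs = \<delta> y / (y - xs)" for y
      using \<psi>_pos \<phi>_pos by (simp add: \<delta>_def diff_divide_distrib mult.commute)
    ultimately show "((\<lambda>y. \<delta> y / (y - xs)) \<longlongrightarrow> d\<psi> * \<sigma> / \<psi> xs - d\<phi> * \<sigma> / \<phi> xs) (at_right xs)"
      by simp
  qed
  obtain g' where g': "(g has_field_derivative g') (at xs)"
    using \<open>g field_differentiable (at xs)\<close> by (auto simp: field_differentiable_def)
  \<comment> \<open>The equality of \<open>v\<close> and \<open>g\<close> is known from
    \<open>xs\<close> to the right; as both functions have a derivative at \<open>xs\<close>,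
    comparing right difference quotients identifies the two.\<close>
  have "\<forall>\<^sub>F x in at_right xs. (v x - v xs) / (x - xs) = (g x - g xs) / (x - xs)"
    using near_right by eventually_elim (simp add: v_g xs_I)
  with has_field_derivative_sides(2)[OF v_deriv]
  have "((\<lambda>x. (g x - g xs) / (x - xs)) \<longlongrightarrow> c * d) (at_right xs)"
    by (rule Lim_transform_eventually)
  then have "c * d = g'"
    using has_field_derivative_sides(2)[OF g'] by (rule tendsto_unique[OF trivial_limit_at_right_real])
  with v_deriv g' show ?thesis
    by (auto simp: v_def field_differentiable_def DERIV_imp_deriv)
qed

end
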